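(* Let $\mathbb{X}$ be a Polish space and let $\mathcal{B}_b\subseteq\mathcal{B}(\mathbb{X})$ be a boundedness which properly localizes $\mathbb{X}$. Let $N,N_1,N_2,\dots$ be random measures on $\mathbb{X}$. Assume that $d$ is a metric on $\mathbb{X}$ which generates the topology of $\mathbb{X}$ and is such that for any $B\in\mathcal{B}_b$ there exists an $\epsilon>0$ such that $B^{\epsilon}=\{x\in\mathbb{X}: d(x,B)\le\epsilon\}\in\mathcal{B}_b$. Then $N_n$ converges in distribution to $N$ in $\mathcal{M}(\mathbb{X})$ (with respect to the vague topology) as $n\to\infty$ if and only if $$\mathbb{E}[e^{-N_n(f)}]\to\mathbb{E}[e^{-N(f)}]\quad\text{as } n\to\infty,\ \text{for every } f\in LB_b^+(\mathbb{X},d).$$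
   Context: A Polish space is a separable topological space which is metrizable by a complete metric; $\mathcal{B}(\mathbb{X})$ denotes the Borel $\sigma$-field of $\mathbb{X}$. A family $\mathcal{B}_b\subseteq\mathcal{B}(\mathbb{X})$ is a (Borel) boundedness in $\mathbb{X}$ if (i) $A\subseteq B\in\mathcal{B}_b$ with $A\in\mathcal{B}(\mathbb{X})$ implies $A\in\mathcal{B}_b$, and (ii) $A,B\in\mathcal{B}_b$ implies $A\cup B\in\mathcal{B}_b$. The elements of $\mathcal{B}_b$ are called bounded sets. A subfamily $\mathcal{C}_b\subseteq\mathcal{B}_b$ is a basis of $\mathcal{B}_b$ if every $B\in\mathcal{B}_b$ is contained in some $C\in\mathcal{C}_b$. The boundedness $\mathcal{B}_b$ is proper if for each $B\in\mathcal{B}_b$ there exists an open set $U\in\mathcal{B}_b$ with $\overline{B}\subseteq U$, where $\overline{B}$ is the closure of $B$. It properly localizes $\mathbb{X}$ if it is proper and has a countable basis which covers $\mathbb{X}$. A Borel measure $\mu$ on $\mathbb{X}$ is locally finite if $\mu(B)<\infty$ for all $B\in\mathcal{B}_b$; $\mathcal{M}(\mathbb{X})=\mathcal{M}(\mathbb{X},\mathcal{B}_b)$ is the set of all such measures. Write $\mu(f)=\int f\,d\mu$. $CB_b^+(\mathbb{X})$ is the family of all nonnegative, bounded, continuous real-valued functions on $\mathbb{X}$ whose support is a bounded set (i.e. belongs to $\mathcal{B}_b$). The vague topology on $\mathcal{M}(\mathbb{X})$ is the smallest topology under which the maps $\mu\mapsto\mu(f)$ are continuous for all $f\in CB_b^+(\mathbb{X})$.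 A random measure on $\mathbb{X}$ is a random element in $\mathcal{M}(\mathbb{X})$ with respect to the smallest $\sigma$-algebra under which the maps $\mu\mapsto\mu(B)$ are measurable for all $B\in\mathcal{B}_b$; this $\sigma$-algebra equals the Borel $\sigma$-algebra of the vague topology. Convergence in distribution in $\mathcal{M}(\mathbb{X})$ is considered with respect to the vague topology. For a metric $d$ on $\mathbb{X}$, $LB_b^+(\mathbb{X},d)$ denotes the family of all bounded nonnegative functions $f$ on $\mathbb{X}$ which have bounded support (support in $\mathcal{B}_b$) and are Lipschitz continuous with respect to $d$. Also $d(x,B)=\inf\{d(x,z): z\in B\}$, with $\inf\emptyset=+\infty$. *)

theory Defs
  imports "HOL-Probability.Probability"
begin

definition boundedness :: "'a::topological_space set set \<Rightarrow> bool" where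
  "boundedness Bb \<longleftrightarrow> Bb \<subseteq> sets borel
     \<and> (\<forall>A B. A \<subseteq> B \<and> B \<in> Bb \<and> A \<in> sets borel \<longrightarrow> A \<in> Bb)
     \<and> (\<forall>A\<in>Bb. \<forall>B\<in>Bb. A \<union> B \<in> Bb)"

definition boundedness_basis :: "'a set set \<Rightarrow> 'a set set \<Rightarrow> bool" where
  "boundedness_basis Bb Cb \<longleftrightarrow> Cb \<subseteq> Bb \<and> (\<forall>B\<in>Bb. \<exists>C\<in>Cb. B \<subseteq> C)"

definition proper_boundedness :: "'a::topological_space set set \<Rightarrow> bool" where
  "proper_boundedness Bb \<longleftrightarrow> (\<forall>B\<in>Bb. \<exists>U\<in>Bb. open U \<and> closure B \<subseteq> U)"

definition properly_localizes :: "'a::topological_space set set \<Rightarrow> bool" where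
  "properly_localizes Bb \<longleftrightarrow> proper_boundedness Bb
     \<and> (\<exists>Cb. countable Cb \<and> boundedness_basis Bb Cb \<and> \<Union>Cb = UNIV)"

definition lf_measures :: "'a::topological_space set set \<Rightarrow> 'a measure set" where
  "lf_measures Bb = {\<mu>. sets \<mu> = sets borel \<and> (\<forall>B\<in>Bb. emeasure \<mu> B < \<infinity>)}"

definition CB_plus :: "'a::topological_space set set \<Rightarrow> ('a \<Rightarrow> real) set" where
  "CB_plus Bb = {f. (\<forall>x. 0 \<le> f x) \<and> bounded (range f) \<and> continuous_on UNIV f
     \<and> closure {x. f x \<noteq> 0} \<in> Bb}"

text \<open>Lipschitz continuity refers to the metric \<open>d\<close>, not to the metric \<open>dist\<close> of the type \<open>'a\<close>.\<close>

definition LB_plus :: "'a::topological_space set set \<Rightarrow> 'a metric \<Rightarrow> ('a \<Rightarrow> real) set" where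
  "LB_plus Bb d = {f. (\<forall>x. 0 \<le> f x) \<and> bounded (range f)
     \<and> Lipschitz_continuous_map d euclidean_metric f
     \<and> closure {x. f x \<noteq> 0} \<in> Bb}"

definition vague_topology :: "'a::topological_space set set \<Rightarrow> 'a measure topology" where
  "vague_topology Bb = topology_generated_by
     {{\<mu> \<in> lf_measures Bb. (\<integral>x. f x \<partial>\<mu>) \<in> U} | f U. f \<in> CB_plus Bb \<and> open U}"

definition lf_measure_algebra :: "'a::topological_space set set \<Rightarrow> 'a measure measure" where
  "lf_measure_algebra Bb = sigma (lf_measures Bb)
     {{\<mu> \<in> lf_measures Bb. emeasure \<mu> B \<in> A} | B A. B \<in> Bb \<and> A \<in> sets borel}"

definition random_measure ::
  "'a::topological_space set set \<Rightarrow> 'b measure \<Rightarrow> ('b \<Rightarrow> 'a measure) \<Rightarrow> bool" where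
  "random_measure Bb P N \<longleftrightarrow> prob_space P \<and> N \<in> measurable P (lf_measure_algebra Bb)"

text \<open>Convergence in distribution of random elements of the topological space \<open>T\<close>; the
  variables may live on different probability spaces.\<close>

definition converges_in_distribution ::
  "'s topology \<Rightarrow> (nat \<Rightarrow> 'b measure) \<Rightarrow> (nat \<Rightarrow> 'b \<Rightarrow> 's) \<Rightarrow> 'c measure \<Rightarrow> ('c \<Rightarrow> 's) \<Rightarrow> bool" where
  "converges_in_distribution T P X Q Y \<longleftrightarrow>
     (\<forall>g :: 's \<Rightarrow> real. continuous_map T euclideanreal g \<and> bounded (g ` topspace T) \<longrightarrow>
        (\<lambda>n. \<integral>\<omega>. g (X n \<omega>) \<partial>P n) \<longlonglongrightarrow> (\<integral>\<omega>. g (Y \<omega>) \<partial>Q))"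

text \<open>The distance to a set is taken in \<open>ennreal\<close>, where the infimum of the empty set is
  \<open>\<infinity>\<close> (unlike \<open>infdist\<close>, which is 0 there).\<close>

definition set_dist :: "'a metric \<Rightarrow> 'a \<Rightarrow> 'a set \<Rightarrow> ennreal" where
  "set_dist d x B = (INF z\<in>B. ennreal (mdist d x z))"

definition enlargement :: "'a metric \<Rightarrow> real \<Rightarrow> 'a set \<Rightarrow> 'a set" where
  "enlargement d \<epsilon> B = {x \<in> mspace d. set_dist d x B \<le> ennreal \<epsilon>}"

lemma topspace_vague_topology:
  assumes "boundedness Bb" "Bb \<noteq> {}"
  shows "topspace (vague_topology Bb) = lf_measures Bb"
proof -
  have "{} \<in> Bb"
    using assms unfolding boundedness_def by blast
  then have "(\<lambda>_. 0) \<in> CB_plus Bb"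
    by (auto simp: CB_plus_def)
  moreover have "lf_measures Bb = {\<mu> \<in> lf_measures Bb. (\<integral>x. 0 \<partial>\<mu>) \<in> (UNIV :: real set)}"
    by simp
  ultimately have "lf_measures Bb \<in>
      {{\<mu> \<in> lf_measures Bb. (\<integral>x. f x \<partial>\<mu>) \<in> U} | f U. f \<in> CB_plus Bb \<and> open U}"
    using open_UNIV by blast
  then show ?thesis
    by (auto simp: vague_topology_def)
qed

end

theory Submission
  imports Defs
begin

text \<open>
  No tightness is needed for the nontrivial direction, because the limit \<open>N\<^sub>0\<close> is given. The functions
  \<open>w\<^sub>f \<mu> = exp (- \<mu>(f))\<close> with \<open>f\<close> Lipschitz form a multiplicative class, so convergence of their expectations
  extends to the uniform closure of their span, which by Weierstrass approximation is a lattice.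
  Countably many of the \<open>w\<^sub>f\<close> generate the vague topology: a function \<open>g\<close> in \<open>CB_plus\<close> is an increasing limit
  of functions from a countable set of Lipschitz functions, so \<open>\<mu> \<mapsto> \<mu>(g)\<close> is lower semicontinuous
  for the generated topology; it is also upper semicontinuous, because \<open>\<mu>(g) = c \<mu>(h) - \<mu>(c h - g)\<close> for
  a Lipschitz \<open>h\<close> with \<open>g \<le> c h\<close>, and this is where enlargements of bounded sets have to be bounded.
  Hence every nonnegative vaguely continuous \<open>g\<close> is an increasing limit of functions in the lattice,
  which gives \<open>liminf E g(N\<^sub>n) \<ge> E g(N\<^sub>0)\<close>; applying this to \<open>c + g\<close> and \<open>c - g\<close> proves the claim.
\<close>

section \<open>Lattice approximation\<close>

text \<open>On \<open>S\<close> the function \<open>g\<close> is the pointwise supremum of the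
  countably many functions \<open>min q (n * m)\<close> that lie below it: the \<open>m\<close>
  supplied by \<open>sep\<close> is positive at \<open>x\<close> and vanishes outside
  \<open>{q < g}\<close>, so the truncation at \<open>q\<close> stays below \<open>g\<close> and
  equals \<open>q\<close> at \<open>x\<close> once \<open>n\<close> is large. Running maxima turn
  the supremum into a limit. The support premise in \<open>Ltent\<close> allows lattices
  \<open>L\<close> of functions with bounded support, where only those \<open>m\<close> that live
  inside \<open>{g > 0}\<close> yield members.\<close>

lemma increasing_lattice_approximation:
  fixes g :: "'s \<Rightarrow> real"
  assumes "countable G" and nn: "\<And>m x. m \<in> G \<Longrightarrow> x \<in> S \<Longrightarrow> 0 \<le> m x"
    and gnn: "\<And>x. x \<in> S \<Longrightarrow> 0 \<le> g x"
    and L0: "(\<lambda>_. 0) \<in> L"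
    and Lmax: "\<And>u v. u \<in> L \<Longrightarrow> v \<in> L \<Longrightarrow> (\<lambda>x. max (u x) (v x)) \<in> L"
    and Ltent: "\<And>m q n. m \<in> G \<Longrightarrow> q \<in> \<rat> \<Longrightarrow> q > 0 \<Longrightarrow>
       (\<And>x. x \<in> S \<Longrightarrow> m x > 0 \<Longrightarrow> g x > 0) \<Longrightarrow> (\<lambda>x. min q (real n * m x)) \<in> L"
    and sep: "\<And>x q. x \<in> S \<Longrightarrow> 0 < q \<Longrightarrow> q < g x \<Longrightarrow>
       \<exists>m\<in>G. m x > 0 \<and> (\<forall>y\<in>S. m y > 0 \<longrightarrow> q < g y)"
  obtains h :: "nat \<Rightarrow> 's \<Rightarrow> real"
  where "\<And>n. h n \<in> L" "\<And>n x. x \<in> S \<Longrightarrow> 0 \<le> h n x" "\<And>n x. x \<in> S \<Longrightarrow> h n x \<le> g x"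
    "\<And>x. x \<in> S \<Longrightarrow> (\<lambda>n. h n x) \<longlonglongrightarrow> g x"
proof -
  \<comment> \<open>The candidates are filtered by membership in \<open>L\<close>, since not every
    truncation need belong to it. The zero function makes \<open>C\<close> nonempty, so that it can
    be enumerated.\<close>
  define C where "C = insert (\<lambda>_. 0) {f \<in> (\<lambda>(q, n, m) x. min q (real n * m x)) ` ({q\<in>\<rat>. 0 < q} \<times> UNIV \<times> G).
     (\<forall>x\<in>S. f x \<le> g x) \<and> f \<in> L}"
  have "countable ((\<lambda>(q, n, m) x. min q (real n * m x)) ` ({q\<in>\<rat>. 0 < q} \<times> (UNIV::nat set) \<times> G))"
    using assms(1) countable_rat
    by (intro countable_image countable_SIGMA) (auto intro: countable_subset[of _ \<rat>])
  then have Cc: "countable C"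
    unfolding C_def by (intro countable_insert) (auto intro: countable_subset)
  have Cne: "C \<noteq> {}" by (auto simp: C_def)
  define c where "c = from_nat_into C"
  have cC: "c n \<in> C" for n unfolding c_def using Cne by (rule from_nat_into)
  have csurj: "\<exists>n. c n = f" if "f \<in> C" for f
    using from_nat_into_surj[OF Cc that] by (auto simp: c_def)
  have CL: "f \<in> L" if "f \<in> C" for f using that L0 by (auto simp: C_def)
  have Cg: "f x \<le> g x" if "f \<in> C" "x \<in> S" for f x using that gnn by (auto simp: C_def)
  have Cnn: "0 \<le> f x" if "f \<in> C" "x \<in> S" for f x
    using that nn by (auto simp: C_def)
  \<comment> \<open>\<open>h n\<close> is the maximum of the first \<open>n + 1\<close> enumerated
    candidates.\<close>
  define h where "h = rec_nat (c 0) (\<lambda>n u x. max (u x) (c (Suc n) x))"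
  have h0: "h 0 = c 0" and hS: "h (Suc n) = (\<lambda>x. max (h n x) (c (Suc n) x))" for n
    by (auto simp: h_def)
  have hL: "h n \<in> L" for n
    by (induction n) (simp_all add: h0 hS Lmax CL[OF cC])
  have hnn: "0 \<le> h n x" if "x \<in> S" for n x
    using that by (induction n) (auto simp: h0 hS intro: Cnn cC le_max_iff_disj[THEN iffD2])
  have hg: "h n x \<le> g x" if "x \<in> S" for n x
    using that by (induction n) (auto simp: h0 hS intro: Cg cC)
  have hc: "c i x \<le> h n x" if "i \<le> n" for i n x
    using that by (induction n) (auto simp: h0 hS le_Suc_eq le_max_iff_disj)
  have "(\<lambda>n. h n x) \<longlonglongrightarrow> g x" if x: "x \<in> S" for x
  proof (rule order_tendstoI)
    fix a assume a: "a < g x"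
    show "eventually (\<lambda>n. a < h n x) sequentially"
    \<comment> \<open>Truncation levels must be positive. Thresholds below 0 are therefore settled
      by \<open>0 \<le> h n x\<close> alone, and otherwise \<open>q > a\<close> is positive.\<close>
    proof (cases "a < 0")
      case True
      then have "a < h n x" for n using hnn[OF x, of n] by linarith
      then show ?thesis by simp
    next
      case False
      obtain q where q: "q \<in> \<rat>" "a < q" "q < g x" using Rats_dense_in_real[OF a] by blast
      with False obtain m where m: "m \<in> G" "m x > 0" "\<And>y. y \<in> S \<Longrightarrow> m y > 0 \<Longrightarrow> q < g y"
        using sep[OF x, of q] by force
      obtain n where n: "q < real n * m x"
        using reals_Archimedean3[OF m(2)] by blast
      define f where "f = (\<lambda>x. min q (real n * m x))"
      have "f \<in> L" unfolding f_def using m q False by (intro Ltent) force+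
      moreover have "f y \<le> g y" if "y \<in> S" for y
      proof (cases "m y > 0")
        case True
        then show ?thesis using m(3)[OF that True] by (auto simp: f_def)
      next
        case False
        then have "m y = 0" using nn[OF m(1) that] by simp
        then show ?thesis using gnn[OF that] by (simp add: f_def)
      qed
      ultimately have "f \<in> C"
        unfolding C_def f_def using q m(1) False by force
      then obtain i where i: "c i = f" using csurj by blast
      have "a < h k x" if "k \<ge> i" for k
        using hc[OF that, of x] q n by (auto simp: i f_def)
      then show ?thesis by (auto simp: eventually_sequentially)
    qed
  next
    fix a assume "g x < a"
    then have "h n x < a" for n using hg[OF x, of n] by linarith
    then show "eventually (\<lambda>n. h n x < a) sequentially" by simp
  qed
  with hL hnn hg show thesis by (rule that)
qed

section \<open>Uniform closure of the span of a multiplicative class\<close>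

inductive_set func_span :: "('s \<Rightarrow> real) set \<Rightarrow> ('s \<Rightarrow> real) set" for W where
  base: "w \<in> W \<Longrightarrow> (\<lambda>x. c * w x) \<in> func_span W"
| add: "u \<in> func_span W \<Longrightarrow> v \<in> func_span W \<Longrightarrow> (\<lambda>x. u x + v x) \<in> func_span W"

text \<open>Approximation is tested on \<open>space S\<close> only, because the type may be larger
  than the space: it contains measures that are not locally finite.\<close>

definition uniform_closure :: "'s measure \<Rightarrow> ('s \<Rightarrow> real) set \<Rightarrow> ('s \<Rightarrow> real) set" where
  "uniform_closure S W = {h \<in> borel_measurable S. \<forall>e>0. \<exists>a\<in>W. \<forall>x\<in>space S. \<bar>h x - a x\<bar> \<le> e}"

text \<open>The model is the class of Laplace functionals. Its product rule rests on additivity of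
  the integral, hence on integrability, so \<open>mult\<close> asks for equality on
  \<open>space S\<close> only.\<close>

locale multiplicative_class =
  fixes S :: "'s measure" and W :: "('s \<Rightarrow> real) set"
  assumes meas: "w \<in> W \<Longrightarrow> w \<in> borel_measurable S"
    and bdd: "w \<in> W \<Longrightarrow> \<exists>c. \<forall>x\<in>space S. \<bar>w x\<bar> \<le> c"
    and one: "(\<lambda>_. 1) \<in> W"
    and mult: "v \<in> W \<Longrightarrow> w \<in> W \<Longrightarrow> \<exists>u\<in>W. \<forall>x\<in>space S. v x * w x = u x"
begin

abbreviation "H \<equiv> uniform_closure S (func_span W)"

lemma span_measurable: "a \<in> func_span W \<Longrightarrow> a \<in> borel_measurable S"
  by (induction rule: func_span.induct) (auto dest: meas)

lemma span_bounded: "a \<in> func_span W \<Longrightarrow> \<exists>c. \<forall>x\<in>space S. \<bar>a x\<bar> \<le> c"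
proof (induction rule: func_span.induct)
  case (base w c)
  then obtain C where "\<forall>x\<in>space S. \<bar>w x\<bar> \<le> C" using bdd by blast
  then have "\<forall>x\<in>space S. \<bar>c * w x\<bar> \<le> \<bar>c\<bar> * C" by (auto simp: abs_mult intro: mult_left_mono)
  then show ?case by blast
next
  case (add u v)
  then obtain C D where "\<forall>x\<in>space S. \<bar>u x\<bar> \<le> C" "\<forall>x\<in>space S. \<bar>v x\<bar> \<le> D" by blast
  then have "\<forall>x\<in>space S. \<bar>u x + v x\<bar> \<le> C + D" by force
  then show ?case by blast
qed

text \<open>A product of two linear combinations expands into products of pairs from
  \<open>W\<close>, each of which agrees with a member of \<open>W\<close> on the space. The outer
  induction runs over \<open>a\<close>, the inner one over \<open>b\<close>.\<close>

lemma span_mult: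
  assumes "a \<in> func_span W" "b \<in> func_span W"
  shows "\<exists>u\<in>func_span W. \<forall>x\<in>space S. a x * b x = u x"
  using assms
proof (induction rule: func_span.induct)
  case (base w c)
  from base(2,1) show ?case
  proof (induction rule: func_span.induct)
    case (base v d)
    then obtain u where "u \<in> W" "\<forall>x\<in>space S. w x * v x = u x" using mult by blast
    then have "c * w x * (d * v x) = c * d * u x" if "x \<in> space S" for x
      using that by (metis mult.assoc mult.left_commute)
    then show ?case
      by (intro bexI[of _ "\<lambda>x. c * d * u x"] ballI func_span.base \<open>u \<in> W\<close>)
  next
    case (add u v)
    then obtain p q where "p \<in> func_span W" "q \<in> func_span W"
      "\<forall>x\<in>space S. c * w x * u x = p x" "\<forall>x\<in>space S. c * w x * v x = q x" by blast
    then show ?case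
      by (intro bexI[of _ "\<lambda>x. p x + q x"]) (auto intro!: func_span.add simp: distrib_left)
  qed
next
  case (add u v)
  then obtain p q where "p \<in> func_span W" "q \<in> func_span W"
      "\<forall>x\<in>space S. u x * b x = p x" "\<forall>x\<in>space S. v x * b x = q x" by blast
  then show ?case
    by (intro bexI[of _ "\<lambda>x. p x + q x"]) (auto intro!: func_span.add simp: distrib_right)
qed

lemma closure_measurable: "h \<in> H \<Longrightarrow> h \<in> borel_measurable S"
  by (simp add: uniform_closure_def)

lemma closure_approx:
  assumes "h \<in> H" "e > 0"
  obtains a where "a \<in> func_span W" "\<And>x. x \<in> space S \<Longrightarrow> \<bar>h x - a x\<bar> \<le> e"
  using assms by (auto simp: uniform_closure_def)

lemma closure_bounded:
  assumes "h \<in> H"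
  obtains c where "c > 0" "\<And>x. x \<in> space S \<Longrightarrow> \<bar>h x\<bar> \<le> c"
proof -
  obtain a where a: "a \<in> func_span W" "\<And>x. x \<in> space S \<Longrightarrow> \<bar>h x - a x\<bar> \<le> 1"
    using closure_approx[OF assms zero_less_one] by blast
  obtain c where "\<forall>x\<in>space S. \<bar>a x\<bar> \<le> c" using span_bounded[OF a(1)] by blast
  with a(2) have "\<bar>h x\<bar> \<le> \<bar>c\<bar> + 1" if "x \<in> space S" for x using that by force
  then show thesis by (intro that[of "\<bar>c\<bar> + 1"]) auto
qed

lemma span_closure: "a \<in> func_span W \<Longrightarrow> a \<in> H"
  using span_measurable by (auto simp: uniform_closure_def intro!: bexI[of _ a])

lemma class_closure: "w \<in> W \<Longrightarrow> w \<in> H"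
  using func_span.base[of w W 1] by (intro span_closure) simp

lemma closure_const: "(\<lambda>_. c) \<in> H"
  using func_span.base[OF one, of c] by (intro span_closure) simp

text \<open>Closing a second time adds nothing, by splitting \<open>e\<close> into two halves. Later
  closure properties may thus approximate by members of \<open>H\<close> instead of members of the
  span.\<close>

lemma closure_limit:
  assumes "h \<in> borel_measurable S"
    and "\<And>e. e > 0 \<Longrightarrow> \<exists>k\<in>H. \<forall>x\<in>space S. \<bar>h x - k x\<bar> \<le> e"
  shows "h \<in> H"
  unfolding uniform_closure_def
proof (safe intro!: assms(1))
  fix e :: real assume "e > 0"
  then obtain k where k: "k \<in> H" "\<forall>x\<in>space S. \<bar>h x - k x\<bar> \<le> e/2" using assms(2)[of "e/2"] by auto
  obtain a where a: "a \<in> func_span W" "\<And>x. x \<in> space S \<Longrightarrow> \<bar>k x - a x\<bar> \<le> e/2"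
    using closure_approx[OF k(1), of "e/2"] \<open>e > 0\<close> by auto
  have "\<bar>h x - a x\<bar> \<le> e" if "x \<in> space S" for x
    using k(2)[rule_format, OF that] a(2)[OF that] by linarith
  with a(1) show "\<exists>a\<in>func_span W. \<forall>x\<in>space S. \<bar>h x - a x\<bar> \<le> e" by blast
qed

lemma closure_add:
  assumes "h \<in> H" "k \<in> H"
  shows "(\<lambda>x. h x + k x) \<in> H"
proof (rule closure_limit)
  show "(\<lambda>x. h x + k x) \<in> borel_measurable S" using assms[THEN closure_measurable] by simp
  fix e :: real assume "e > 0"
  then have e: "e/2 > 0" by simp
  obtain a where a: "a \<in> func_span W" "\<And>x. x \<in> space S \<Longrightarrow> \<bar>h x - a x\<bar> \<le> e/2"
    using closure_approx[OF assms(1) e] by blast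
  obtain b where b: "b \<in> func_span W" "\<And>x. x \<in> space S \<Longrightarrow> \<bar>k x - b x\<bar> \<le> e/2"
    using closure_approx[OF assms(2) e] by blast
  have "\<bar>(h x + k x) - (a x + b x)\<bar> \<le> e" if "x \<in> space S" for x
    using a(2)[OF that] b(2)[OF that] by linarith
  then show "\<exists>u\<in>H. \<forall>x\<in>space S. \<bar>h x + k x - u x\<bar> \<le> e"
    using a b by (intro bexI[of _ "\<lambda>x. a x + b x"] span_closure func_span.add) auto
qed

text \<open>The error splits as \<open>h k - a b = h (k - b) + b (h - a)\<close>. First
  \<open>b\<close> is chosen with accuracy \<open>e / (2 * c)\<close>, where \<open>c\<close> bounds
  \<open>h\<close>; only then can \<open>a\<close> be chosen, since its accuracy
  \<open>e / (2 * d)\<close> depends on the bound \<open>d\<close> of \<open>b\<close>.\<close>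

lemma closure_mult:
  assumes "h \<in> H" "k \<in> H"
  shows "(\<lambda>x. h x * k x) \<in> H"
proof (rule closure_limit)
  show "(\<lambda>x. h x * k x) \<in> borel_measurable S" using assms[THEN closure_measurable] by simp
  fix e :: real assume "e > 0"
  obtain c where c: "c > 0" "\<And>x. x \<in> space S \<Longrightarrow> \<bar>h x\<bar> \<le> c"
    using closure_bounded[OF assms(1)] by blast
  have "e / (2 * c) > 0" using c \<open>e > 0\<close> by simp
  then obtain b where b: "b \<in> func_span W" "\<And>x. x \<in> space S \<Longrightarrow> \<bar>k x - b x\<bar> \<le> e / (2 * c)"
    using closure_approx[OF assms(2)] by blast
  obtain d where d: "d > 0" "\<And>x. x \<in> space S \<Longrightarrow> \<bar>b x\<bar> \<le> d"
    using closure_bounded[OF span_closure[OF b(1)]] by blast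
  have "e / (2 * d) > 0" using d \<open>e > 0\<close> by simp
  then obtain a where a: "a \<in> func_span W" "\<And>x. x \<in> space S \<Longrightarrow> \<bar>h x - a x\<bar> \<le> e / (2 * d)"
    using closure_approx[OF assms(1)] by blast
  obtain u where u: "u \<in> func_span W" "\<forall>x\<in>space S. a x * b x = u x"
    using span_mult[OF a(1) b(1)] by blast
  have "\<bar>h x * k x - u x\<bar> \<le> e" if x: "x \<in> space S" for x
  proof -
    have "\<bar>h x * k x - u x\<bar> = \<bar>h x * (k x - b x) + b x * (h x - a x)\<bar>"
      using u(2) x by (simp add: algebra_simps)
    also have "\<dots> \<le> \<bar>h x\<bar> * \<bar>k x - b x\<bar> + \<bar>b x\<bar> * \<bar>h x - a x\<bar>"
      by (metis abs_mult abs_triangle_ineq)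
    also have "\<dots> \<le> c * (e / (2 * c)) + d * (e / (2 * d))"
      using a(2)[OF x] b(2)[OF x] c(2)[OF x] d(2)[OF x] c(1) d(1)
      by (intro add_mono mult_mono) auto
    also have "\<dots> = e" using c(1) d(1) by (simp add: field_simps)
    finally show ?thesis .
  qed
  then show "\<exists>u\<in>H. \<forall>x\<in>space S. \<bar>h x * k x - u x\<bar> \<le> e"
    using u(1) span_closure by blast
qed

lemma closure_power: "h \<in> H \<Longrightarrow> (\<lambda>x. h x ^ n) \<in> H"
  by (induction n) (simp_all add: closure_const closure_mult)

lemma closure_sum:
  assumes "finite I" "\<And>i. i \<in> I \<Longrightarrow> h i \<in> H"
  shows "(\<lambda>x. \<Sum>i\<in>I. h i x) \<in> H"
  using assms by (induction rule: finite_induct) (simp_all add: closure_const closure_add)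

lemma closure_cmult: "h \<in> H \<Longrightarrow> (\<lambda>x. c * h x) \<in> H"
  using closure_mult[OF closure_const] .

lemma closure_diff: "h \<in> H \<Longrightarrow> k \<in> H \<Longrightarrow> (\<lambda>x. h x - k x) \<in> H"
  using closure_add[of h "\<lambda>x. - 1 * k x"] closure_cmult[of k "- 1"] by simp

text \<open>By Weierstrass, the absolute value is a uniform limit of polynomials on the bounded
  range of \<open>h\<close>, and polynomials in \<open>h\<close> lie in the algebra
  \<open>H\<close>. This is what makes \<open>H\<close> a lattice.\<close>

lemma closure_abs:
  assumes "h \<in> H"
  shows "(\<lambda>x. \<bar>h x\<bar>) \<in> H"
proof (rule closure_limit)
  show "(\<lambda>x. \<bar>h x\<bar>) \<in> borel_measurable S" using closure_measurable[OF assms] by simp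
  fix e :: real assume "e > 0"
  obtain c where c: "c > 0" "\<And>x. x \<in> space S \<Longrightarrow> \<bar>h x\<bar> \<le> c"
    using closure_bounded[OF assms] by blast
  \<comment> \<open>Bernstein polynomials live on the unit interval. The map
    \<open>t = h / (2 * c) + 1 / 2\<close> carries the interval from \<open>-c\<close> to
    \<open>c\<close> onto it, and \<open>\<phi>\<close> is the absolute value in the new
    variable.\<close>
  define \<phi> where "\<phi> = (\<lambda>t::real. \<bar>2 * c * t - c\<bar>)"
  have "continuous_on {0..1} \<phi>" unfolding \<phi>_def by (intro continuous_intros)
  from Bernstein_Weierstrass[OF this \<open>e > 0\<close>] obtain n where
    n: "\<And>t. t \<in> {0..1} \<Longrightarrow> \<bar>\<phi> t - (\<Sum>k\<le>n. \<phi> (k/n) * Bernstein n k t)\<bar> < e" by (meson order_refl)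
  define t where "t = (\<lambda>x. 1 / (2 * c) * h x + 1 / 2)"
  have tH: "t \<in> H" unfolding t_def by (intro closure_add closure_cmult closure_const assms)
  have t: "2 * c * t x - c = h x" for x using c(1) by (simp add: t_def field_simps)
  have "t x \<in> {0..1}" if "x \<in> space S" for x
  proof -
    have "0 \<le> 2 * c * t x" "2 * c * t x \<le> 2 * c * 1" using c(2)[OF that] t[of x] by linarith+
    then show ?thesis using c(1) by (simp add: zero_le_mult_iff)
  qed
  then have approx: "\<bar>\<bar>h x\<bar> - (\<Sum>k\<le>n. \<phi> (k/n) * Bernstein n k (t x))\<bar> \<le> e" if "x \<in> space S" for x
    using n[of "t x"] that t[of x] by (simp add: \<phi>_def less_imp_le)
  have "(\<lambda>x. Bernstein n k (t x)) \<in> H" for k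
    unfolding Bernstein_def by (rule closure_mult closure_power closure_diff closure_const tH)+
  then have sumH: "(\<lambda>x. \<Sum>k\<le>n. \<phi> (k/n) * Bernstein n k (t x)) \<in> H"
    by (rule closure_sum[OF finite_atMost closure_cmult])
  show "\<exists>k\<in>H. \<forall>x\<in>space S. \<bar>\<bar>h x\<bar> - k x\<bar> \<le> e"
    by (intro bexI[OF _ sumH] ballI approx)
qed

lemma closure_max:
  assumes "h \<in> H" "k \<in> H"
  shows "(\<lambda>x. max (h x) (k x)) \<in> H"
proof -
  have "(\<lambda>x. max (h x) (k x)) = (\<lambda>x. 1/2 * (h x + k x + \<bar>h x - k x\<bar>))"
    by (auto simp: max_def fun_eq_iff)
  moreover have "(\<lambda>x. 1/2 * (h x + k x + \<bar>h x - k x\<bar>)) \<in> H"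
    by (rule closure_cmult closure_add closure_abs closure_diff assms)+
  ultimately show ?thesis by metis
qed

lemma closure_min:
  assumes "h \<in> H" "k \<in> H"
  shows "(\<lambda>x. min (h x) (k x)) \<in> H"
proof -
  have "(\<lambda>x. min (h x) (k x)) = (\<lambda>x. h x + k x - max (h x) (k x))"
    by (auto simp: max_def min_def fun_eq_iff)
  moreover have "(\<lambda>x. h x + k x - max (h x) (k x)) \<in> H"
    by (rule closure_diff closure_add closure_max assms)+
  ultimately show ?thesis by metis
qed

end

section \<open>Convergence-determining classes\<close>

lemma integrable_bounded_comp:
  fixes f :: "'s \<Rightarrow> real"
  assumes "prob_space M" "X \<in> measurable M S"
    and "f \<in> borel_measurable S" "\<And>x. x \<in> space S \<Longrightarrow> \<bar>f x\<bar> \<le> c"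
  shows "integrable M (\<lambda>\<omega>. f (X \<omega>))"
proof -
  interpret prob_space M by fact
  show ?thesis
    using assms(4) measurable_space[OF assms(2)] measurable_compose[OF assms(2,3)]
    by (intro integrable_const_bound[where B = c]) auto
qed

lemma integral_affine_comp:
  fixes f :: "'s \<Rightarrow> real"
  assumes "prob_space M" "X \<in> measurable M S"
    and "f \<in> borel_measurable S" "\<And>x. x \<in> space S \<Longrightarrow> \<bar>f x\<bar> \<le> C"
  shows "(\<integral>\<omega>. s * f (X \<omega>) + c \<partial>M) = s * (\<integral>\<omega>. f (X \<omega>) \<partial>M) + c"
  using integrable_bounded_comp[OF assms] prob_space.prob_space[OF assms(1)]
    prob_space.finite_measure[OF assms(1), THEN finite_measure.integrable_const, of c]
  by simp

context multiplicative_class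
begin

lemma closure_integrable:
  assumes "prob_space M" "X \<in> measurable M S" "h \<in> H"
  shows "integrable M (\<lambda>\<omega>. h (X \<omega>))"
proof -
  obtain c where "\<And>x. x \<in> space S \<Longrightarrow> \<bar>h x\<bar> \<le> c" using closure_bounded[OF assms(3)] by blast
  with assms closure_measurable show ?thesis by (intro integrable_bounded_comp) auto
qed

lemma closure_integral_diff:
  assumes "prob_space M" "X \<in> measurable M S" "h \<in> H" "k \<in> H"
    and "\<And>x. x \<in> space S \<Longrightarrow> \<bar>h x - k x\<bar> \<le> e"
  shows "\<bar>(\<integral>\<omega>. h (X \<omega>) \<partial>M) - (\<integral>\<omega>. k (X \<omega>) \<partial>M)\<bar> \<le> e"
proof -
  interpret prob_space M by fact
  note int = closure_integrable[OF assms(1,2)]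
  have diff: "(\<integral>\<omega>. h (X \<omega>) \<partial>M) - (\<integral>\<omega>. k (X \<omega>) \<partial>M) = (\<integral>\<omega>. h (X \<omega>) - k (X \<omega>) \<partial>M)"
    using int[OF assms(3)] int[OF assms(4)] by simp
  have bound: "\<bar>h (X \<omega>) - k (X \<omega>)\<bar> \<le> e" if "\<omega> \<in> space M" for \<omega>
    using assms(5) measurable_space[OF assms(2) that] by blast
  have "- e \<le> h (X \<omega>) - k (X \<omega>)" "h (X \<omega>) - k (X \<omega>) \<le> e" if "\<omega> \<in> space M" for \<omega>
    using bound[OF that] by linarith+
  then have "(\<integral>\<omega>. h (X \<omega>) - k (X \<omega>) \<partial>M) \<le> e" "- e \<le> (\<integral>\<omega>. h (X \<omega>) - k (X \<omega>) \<partial>M)"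
    using int[OF assms(3)] int[OF assms(4)]
    by (intro integral_le_const integral_ge_const; simp)+
  then show ?thesis unfolding diff by linarith
qed

text \<open>For members of the span this is linearity. The passage to \<open>H\<close> is a
  three-epsilon argument: the approximation is uniform on the space and every \<open>P n\<close> has
  mass one, so its error is the same for all \<open>n\<close>.\<close>

lemma closure_converges:
  assumes PX: "\<And>n. prob_space (P n)" "\<And>n. X n \<in> measurable (P n) S"
    and QY: "prob_space Q" "Y \<in> measurable Q S"
    and conv: "\<And>w. w \<in> W \<Longrightarrow> (\<lambda>n. \<integral>\<omega>. w (X n \<omega>) \<partial>P n) \<longlonglongrightarrow> (\<integral>\<omega>. w (Y \<omega>) \<partial>Q)"
    and h: "h \<in> H"
  shows "(\<lambda>n. \<integral>\<omega>. h (X n \<omega>) \<partial>P n) \<longlonglongrightarrow> (\<integral>\<omega>. h (Y \<omega>) \<partial>Q)"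
proof -
  have span: "(\<lambda>n. \<integral>\<omega>. a (X n \<omega>) \<partial>P n) \<longlonglongrightarrow> (\<integral>\<omega>. a (Y \<omega>) \<partial>Q)" if "a \<in> func_span W" for a
    using that
  proof (induction rule: func_span.induct)
    case (base w c)
    then show ?case using tendsto_mult_left[OF conv] by simp
  next
    case (add u v)
    note int = closure_integrable[OF PX span_closure] closure_integrable[OF QY span_closure]
    from int add show ?case
      by (simp add: tendsto_add)
  qed
  show ?thesis
  proof (rule LIMSEQ_I)
    fix e :: real assume "e > 0"
    then have e: "e / 3 > 0" by simp
    obtain a where a: "a \<in> func_span W" "\<And>x. x \<in> space S \<Longrightarrow> \<bar>h x - a x\<bar> \<le> e / 3"
      using closure_approx[OF h e] by blast
    obtain n0 where n0: "\<And>n. n \<ge> n0 \<Longrightarrow> \<bar>(\<integral>\<omega>. a (X n \<omega>) \<partial>P n) - (\<integral>\<omega>. a (Y \<omega>) \<partial>Q)\<bar> < e / 3"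
      using LIMSEQ_D[OF span[OF a(1)] e] by auto
    note diff = closure_integral_diff[OF _ _ h span_closure[OF a(1)] a(2)]
    have "\<bar>(\<integral>\<omega>. h (X n \<omega>) \<partial>P n) - (\<integral>\<omega>. h (Y \<omega>) \<partial>Q)\<bar> < e" if "n \<ge> n0" for n
      using diff[OF PX, of n] diff[OF QY] n0[OF that] by linarith
    then show "\<exists>n0. \<forall>n\<ge>n0. norm ((\<integral>\<omega>. h (X n \<omega>) \<partial>P n) - (\<integral>\<omega>. h (Y \<omega>) \<partial>Q)) < e"
      by auto
  qed
qed

text \<open>The premise \<open>nbhd\<close> says that every open set of \<open>T\<close> is open for
  the topology generated by \<open>V\<close>. Basic neighbourhoods with rational centres and radii
  form a countable family, each of them being the positivity set of a function in \<open>H\<close>;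
  these functions serve as separating functions for the lattice approximation with
  \<open>L = H\<close>.\<close>

lemma continuous_approximation:
  fixes g :: "'s \<Rightarrow> real"
  assumes V: "countable V" "V \<subseteq> W"
    and T: "topspace T = space S"
    and nbhd: "\<And>U x. openin T U \<Longrightarrow> x \<in> U \<Longrightarrow>
      \<exists>I \<delta>. finite I \<and> I \<subseteq> V \<and> \<delta> > 0 \<and> (\<forall>y\<in>space S. (\<forall>v\<in>I. \<bar>v y - v x\<bar> < \<delta>) \<longrightarrow> y \<in> U)"
    and g: "continuous_map T euclideanreal g" "\<And>x. x \<in> space S \<Longrightarrow> 0 \<le> g x"
  obtains h :: "nat \<Rightarrow> 's \<Rightarrow> real"
  where "\<And>n. h n \<in> H" "\<And>n x. x \<in> space S \<Longrightarrow> 0 \<le> h n x" "\<And>n x. x \<in> space S \<Longrightarrow> h n x \<le> g x"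
    "\<And>x. x \<in> space S \<Longrightarrow> (\<lambda>n. h n x) \<longlonglongrightarrow> g x"
proof -
  note result = that
  \<comment> \<open>\<open>m (r, l)\<close> is the minimum of \<open>r\<close> and the positive
    parts of \<open>r - \<bar>v - c\<bar>\<close> over the pairs \<open>(v, c)\<close> in
    \<open>l\<close>. It is positive exactly where every \<open>v\<close> is within \<open>r\<close>
    of its \<open>c\<close>.\<close>
  define m where "m = (\<lambda>(r::real, l) y. foldr (\<lambda>(v :: 's \<Rightarrow> real, c) z. min (max 0 (r - \<bar>v y - c\<bar>)) z) l r)"
  define G where "G = m ` ({r\<in>\<rat>. 0 < r} \<times> lists (V \<times> \<rat>))"
  have mpos: "0 < m (r, l) y \<longleftrightarrow> (\<forall>(v, c)\<in>set l. \<bar>v y - c\<bar> < r)" if "r > 0" for r l and y :: 's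
    using that by (induction l) (auto simp: m_def)
  have mnn: "0 \<le> m (r, l) y" if "r > 0" for r l and y :: 's
    using that by (induction l) (auto simp: m_def)
  have mH: "m (r, l) \<in> H" if "l \<in> lists (V \<times> \<rat>)" for r l
    using that
  proof (induction l)
    case Nil
    then show ?case by (simp add: m_def closure_const)
  next
    case (Cons p l)
    obtain v c where p: "p = (v, c)" "v \<in> V" using Cons.hyps by (cases p) auto
    have "(\<lambda>y. min (max 0 (r - \<bar>v y - c\<bar>)) (m (r, l) y)) \<in> H"
      using Cons.IH p(2) V(2)
      by (intro closure_min closure_max closure_diff closure_abs closure_const) (auto intro: class_closure)
    then show ?case by (simp add: m_def p(1))
  qed
  have countG: "countable G" unfolding G_def
    using V(1) countable_rat
    by (intro countable_image countable_SIGMA countable_lists) (auto intro: countable_subset[of _ \<rat>])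
  have nnG: "0 \<le> k x" if "k \<in> G" for k x using that mnn by (auto simp: G_def)
  have tentG: "(\<lambda>x. min q (real n * k x)) \<in> H" if "k \<in> G" for k q n
  proof (intro closure_min closure_const closure_cmult)
    show "k \<in> H" using that mH by (auto simp: G_def)
  qed
  have sepG: "\<exists>k\<in>G. k x > 0 \<and> (\<forall>y\<in>space S. k y > 0 \<longrightarrow> q < g y)"
    if x: "x \<in> space S" and q: "q < g x" for x q
  proof -
    have "openin T {y \<in> topspace T. g y \<in> {q<..}}"
      using g(1) by (rule openin_continuous_map_preimage) auto
    from nbhd[OF this, of x] obtain I \<delta> where I: "finite I" "I \<subseteq> V" "\<delta> > 0"
      and U: "\<And>y. y \<in> space S \<Longrightarrow> (\<And>v. v \<in> I \<Longrightarrow> \<bar>v y - v x\<bar> < \<delta>) \<Longrightarrow> q < g y"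
      using x q T by auto
    \<comment> \<open>Values within \<open>r\<close> of a common \<open>c v\<close> differ by less
      than \<open>2 * r\<close>, which is below \<open>\<delta>\<close>.\<close>
    obtain r where r: "r \<in> \<rat>" "0 < r" "r < \<delta> / 2"
      using Rats_dense_in_real[of 0 "\<delta> / 2"] I(3) by auto
    have "\<exists>c\<in>\<rat>. \<bar>v x - c\<bar> < r" for v :: "'s \<Rightarrow> real"
      using Rats_dense_in_real[of "v x" "v x + r"] r(2) by force
    then obtain c where c: "\<And>v. c v \<in> \<rat>" "\<And>v::'s \<Rightarrow> real. \<bar>v x - c v\<bar> < r" by metis
    obtain l where l: "set l = I" using finite_list[OF I(1)] by blast
    define l' where "l' = map (\<lambda>v. (v, c v)) l"
    have "l' \<in> lists (V \<times> \<rat>)" using I(2) c(1) l by (auto simp: l'_def)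
    then have "m (r, l') \<in> G" using r by (auto simp: G_def)
    moreover have "0 < m (r, l') x" using c(2) r by (auto simp: mpos l'_def)
    moreover have "q < g y" if y: "y \<in> space S" "0 < m (r, l') y" for y
    proof (rule U[OF y(1)])
      fix v assume "v \<in> I"
      then have "\<bar>v y - c v\<bar> < r" using y(2) r l by (auto simp: mpos l'_def)
      then show "\<bar>v y - v x\<bar> < \<delta>" using c(2)[of v] r(3) by linarith
    qed
    ultimately show ?thesis by blast
  qed
  show thesis
  proof (rule increasing_lattice_approximation[of G "space S" g H])
    show "(\<lambda>x. max (u x) (v x)) \<in> H" if "u \<in> H" "v \<in> H" for u v
      using that by (rule closure_max)
    show "thesis" if "\<And>n. h n \<in> H" "\<And>n x. x \<in> space S \<Longrightarrow> 0 \<le> h n x"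
      "\<And>n x. x \<in> space S \<Longrightarrow> h n x \<le> g x"
      "\<And>x. x \<in> space S \<Longrightarrow> (\<lambda>n. h n x) \<longlonglongrightarrow> g x" for h
      using that by (rule result)
  qed (simp_all add: countG nnG g(2) closure_const tentG sepG)
qed

text \<open>A lower bound on the limit inferior for nonnegative functions suffices, since a bounded
  function can be shifted to a nonnegative one both with its own sign and with the opposite
  sign.\<close>

theorem converges_in_distribution_class:
  assumes V: "countable V" "V \<subseteq> W"
    and T: "topspace T = space S"
    and nbhd: "\<And>U x. openin T U \<Longrightarrow> x \<in> U \<Longrightarrow>
      \<exists>I \<delta>. finite I \<and> I \<subseteq> V \<and> \<delta> > 0 \<and> (\<forall>y\<in>space S. (\<forall>v\<in>I. \<bar>v y - v x\<bar> < \<delta>) \<longrightarrow> y \<in> U)"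
    and PX: "\<And>n. prob_space (P n)" "\<And>n. X n \<in> measurable (P n) S"
    and QY: "prob_space Q" "Y \<in> measurable Q S"
    and conv: "\<And>w. w \<in> W \<Longrightarrow> (\<lambda>n. \<integral>\<omega>. w (X n \<omega>) \<partial>P n) \<longlonglongrightarrow> (\<integral>\<omega>. w (Y \<omega>) \<partial>Q)"
  shows "converges_in_distribution T P X Q Y"
  unfolding converges_in_distribution_def
proof (intro allI impI, elim conjE)
  fix g :: "'s \<Rightarrow> real"
  assume cont: "continuous_map T euclideanreal g" and "bounded (g ` topspace T)"
  then obtain c where c: "\<And>x. x \<in> space S \<Longrightarrow> \<bar>g x\<bar> \<le> c"
    unfolding T bounded_iff by auto
  have approx: thesis if "continuous_map T euclideanreal f" "\<And>x. x \<in> space S \<Longrightarrow> 0 \<le> f x"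
      "\<And>h. (\<And>n. h n \<in> H) \<Longrightarrow> (\<And>n x. x \<in> space S \<Longrightarrow> 0 \<le> h n x) \<Longrightarrow> (\<And>n x. x \<in> space S \<Longrightarrow> h n x \<le> f x)
        \<Longrightarrow> (\<And>x. x \<in> space S \<Longrightarrow> (\<lambda>n. h n x) \<longlonglongrightarrow> f x) \<Longrightarrow> thesis" for thesis f
    using continuous_approximation[OF V T nbhd that(1,2), of thesis] that(3) by blast
  \<comment> \<open>Measurability of continuous functions is not assumed: it follows because such a
    function is a pointwise limit of members of \<open>H\<close>.\<close>
  have meas: "f \<in> borel_measurable S"
    if f: "continuous_map T euclideanreal f" "\<And>x. x \<in> space S \<Longrightarrow> 0 \<le> f x" for f
    using f
  proof (rule approx)
    fix h assume "\<And>n. h n \<in> H" "\<And>x. x \<in> space S \<Longrightarrow> (\<lambda>n. h n x) \<longlonglongrightarrow> f x"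
    then show ?thesis using borel_measurable_LIMSEQ_real closure_measurable by blast
  qed
  have lower: "eventually (\<lambda>n. a < (\<integral>\<omega>. f (X n \<omega>) \<partial>P n)) sequentially"
    if f: "continuous_map T euclideanreal f" "\<And>x. x \<in> space S \<Longrightarrow> 0 \<le> f x" "\<And>x. x \<in> space S \<Longrightarrow> f x \<le> C"
      and a: "a < (\<integral>\<omega>. f (Y \<omega>) \<partial>Q)" for f and C a :: real
    using f(1,2)
  proof (rule approx)
    fix h assume h: "\<And>n. h n \<in> H" "\<And>n x. x \<in> space S \<Longrightarrow> 0 \<le> h n x" "\<And>n x. x \<in> space S \<Longrightarrow> h n x \<le> f x"
      "\<And>x. x \<in> space S \<Longrightarrow> (\<lambda>n. h n x) \<longlonglongrightarrow> f x"
    have fm: "f \<in> borel_measurable S" using meas[OF f(1,2)] .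
    have fC: "\<bar>f x\<bar> \<le> C" if "x \<in> space S" for x using f(2,3) that by force
    \<comment> \<open>Since \<open>0 \<le> h k \<le> f\<close>, the bounded function
      \<open>f\<close> itself dominates the sequence.\<close>
    have "(\<lambda>k. \<integral>\<omega>. h k (Y \<omega>) \<partial>Q) \<longlonglongrightarrow> (\<integral>\<omega>. f (Y \<omega>) \<partial>Q)"
    proof (rule integral_dominated_convergence[where w = "\<lambda>\<omega>. f (Y \<omega>)"])
      show "AE \<omega> in Q. (\<lambda>k. h k (Y \<omega>)) \<longlonglongrightarrow> f (Y \<omega>)"
        using h(4) measurable_space[OF QY(2)] by auto
      show "AE \<omega> in Q. norm (h k (Y \<omega>)) \<le> f (Y \<omega>)" for k
        using h(2,3) measurable_space[OF QY(2)] by auto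
      show "integrable Q (\<lambda>\<omega>. f (Y \<omega>))" using QY fm fC by (rule integrable_bounded_comp)
      then show "(\<lambda>\<omega>. f (Y \<omega>)) \<in> borel_measurable Q" by simp
      show "(\<lambda>\<omega>. h k (Y \<omega>)) \<in> borel_measurable Q" for k
        using QY(2) closure_measurable[OF h(1)] by (rule measurable_compose)
    qed
    \<comment> \<open>A single \<open>k\<close> is enough: the expectations of \<open>h k\<close>
      are known to converge, and \<open>f\<close> lies above \<open>h k\<close> along the whole
      sequence.\<close>
    from order_tendstoD(1)[OF this a] obtain k where k: "a < (\<integral>\<omega>. h k (Y \<omega>) \<partial>Q)"
      using eventually_happens'[OF sequentially_bot] by blast
    have "eventually (\<lambda>n. a < (\<integral>\<omega>. h k (X n \<omega>) \<partial>P n)) sequentially"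
      using closure_converges[OF PX QY conv h(1)] k by (rule order_tendstoD(1))
    moreover have "(\<integral>\<omega>. h k (X n \<omega>) \<partial>P n) \<le> (\<integral>\<omega>. f (X n \<omega>) \<partial>P n)" for n
      using h(3) measurable_space[OF PX(2)]
        closure_integrable[OF PX h(1)] integrable_bounded_comp[OF PX fm fC]
      by (intro integral_mono) auto
    ultimately show ?thesis by (elim eventually_mono) (rule less_le_trans)
  qed
  \<comment> \<open>As \<open>g\<close> may take negative values, measurability is proved for
    \<open>g + c\<close> and the constant is subtracted again.\<close>
  have gm: "g \<in> borel_measurable S"
  proof -
    have "(\<lambda>x. g x + c) \<in> borel_measurable S"
    proof (rule meas)
      show "0 \<le> g x + c" if "x \<in> space S" for x using c[OF that] by linarith
    qed (intro continuous_map_add cont, simp)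
    from borel_measurable_diff[OF this borel_measurable_const[of c]] show ?thesis by simp
  qed
  note affine = integral_affine_comp[OF _ _ gm c]
  \<comment> \<open>The values of \<open>s * g + c\<close> lie between 0 and \<open>2 * c\<close>
    for both signs. The shift adds exactly \<open>c\<close> to every expectation, so it
    cancels.\<close>
  have bound: "eventually (\<lambda>n. a < s * (\<integral>\<omega>. g (X n \<omega>) \<partial>P n)) sequentially"
    if s: "s \<in> {-1, 1}" and a: "a < s * (\<integral>\<omega>. g (Y \<omega>) \<partial>Q)" for a s
  proof -
    have "eventually (\<lambda>n. a + c < (\<integral>\<omega>. s * g (X n \<omega>) + c \<partial>P n)) sequentially"
    proof (rule lower[where f = "\<lambda>x. s * g x + c" and C = "2 * c"])
      show "0 \<le> s * g x + c" "s * g x + c \<le> 2 * c" if "x \<in> space S" for x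
        using c[OF that] s by auto
      show "a + c < (\<integral>\<omega>. s * g (Y \<omega>) + c \<partial>Q)" using a affine[OF QY] by simp
    qed (intro continuous_map_add continuous_map_real_mult cont; simp)
    then show ?thesis
      using affine[OF PX] by simp
  qed
  show "(\<lambda>n. \<integral>\<omega>. g (X n \<omega>) \<partial>P n) \<longlonglongrightarrow> (\<integral>\<omega>. g (Y \<omega>) \<partial>Q)"
  proof (rule order_tendstoI)
    fix a assume "a < (\<integral>\<omega>. g (Y \<omega>) \<partial>Q)"
    then show "eventually (\<lambda>n. a < (\<integral>\<omega>. g (X n \<omega>) \<partial>P n)) sequentially"
      using bound[of 1 a] by simp
  next
    fix a assume "(\<integral>\<omega>. g (Y \<omega>) \<partial>Q) < a"
    then show "eventually (\<lambda>n. (\<integral>\<omega>. g (X n \<omega>) \<partial>P n) < a) sequentially"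
      using bound[of "- 1" "- a"] by simp
  qed
qed

end

section \<open>Locally finite measures and the vague topology\<close>

locale localizing_boundedness =
  fixes Bb :: "'a::polish_space set set"
  assumes boundedness: "boundedness Bb" and localizes: "properly_localizes Bb"
begin

abbreviation "\<M> \<equiv> lf_measures Bb"

lemma bounded_borel: "B \<in> Bb \<Longrightarrow> B \<in> sets borel"
  using boundedness by (auto simp: boundedness_def)

lemma bounded_subset: "A \<subseteq> B \<Longrightarrow> B \<in> Bb \<Longrightarrow> A \<in> sets borel \<Longrightarrow> A \<in> Bb"
  using boundedness unfolding boundedness_def by blast

lemma bounded_Un: "A \<in> Bb \<Longrightarrow> B \<in> Bb \<Longrightarrow> A \<union> B \<in> Bb"
  using boundedness unfolding boundedness_def by blast

lemma countable_basis_bounded: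
  obtains Cb where "countable Cb" "Cb \<subseteq> Bb" "\<And>B. B \<in> Bb \<Longrightarrow> \<exists>C\<in>Cb. B \<subseteq> C" "\<Union>Cb = UNIV"
  using localizes unfolding properly_localizes_def boundedness_basis_def by blast

lemma bounded_nonempty: "Bb \<noteq> {}"
  using countable_basis_bounded by (metis Union_empty empty_not_UNIV subset_empty)

lemma bounded_empty: "{} \<in> Bb"
  using bounded_nonempty bounded_subset by blast

lemma bounded_closure:
  assumes "B \<in> Bb"
  shows "closure B \<in> Bb"
proof -
  obtain U where "U \<in> Bb" "closure B \<subseteq> U"
    using localizes assms unfolding properly_localizes_def proper_boundedness_def by blast
  then show ?thesis using bounded_subset by auto
qed

lemma bounded_closure_subset: "A \<subseteq> B \<Longrightarrow> B \<in> Bb \<Longrightarrow> closure A \<in> Bb"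
  using bounded_subset[OF closure_mono bounded_closure] by auto

lemma CB_plusD:
  assumes "f \<in> CB_plus Bb"
  shows "0 \<le> f x" "continuous_on UNIV f" "f \<in> borel_measurable borel" "closure {x. f x \<noteq> 0} \<in> Bb"
    "\<exists>c>0. \<forall>x. f x \<le> c"
proof -
  have "bounded (range f)" using assms by (simp add: CB_plus_def)
  then obtain c where "\<And>x. norm (f x) \<le> c" unfolding bounded_iff by blast
  then have "f x \<le> \<bar>c\<bar> + 1" for x unfolding real_norm_def by (meson abs_ge_self add_increasing2 order_trans zero_le_one)
  then show "\<exists>c>0. \<forall>x. f x \<le> c" by (intro exI[of _ "\<bar>c\<bar> + 1"]) auto
qed (use assms in \<open>auto simp: CB_plus_def intro: borel_measurable_continuous_onI\<close>)

lemma lf_measuresD: "\<mu> \<in> \<M> \<Longrightarrow> sets \<mu> = sets borel" "\<mu> \<in> \<M> \<Longrightarrow> B \<in> Bb \<Longrightarrow> emeasure \<mu> B < \<infinity>"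
  by (auto simp: lf_measures_def)

lemma lf_measurable: "\<mu> \<in> \<M> \<Longrightarrow> f \<in> borel_measurable borel \<Longrightarrow> f \<in> borel_measurable \<mu>"
  using lf_measuresD(1) measurable_cong_sets by blast

lemma CB_plus_integrable:
  assumes f: "f \<in> CB_plus Bb" and \<mu>: "\<mu> \<in> \<M>"
  shows "integrable \<mu> f"
proof -
  obtain c where c: "\<And>x. f x \<le> c" using CB_plusD(5)[OF f] by blast
  show ?thesis
  proof (rule integrableI_bounded_set)
    show "closure {x. f x \<noteq> 0} \<in> sets \<mu>" using lf_measuresD(1)[OF \<mu>] by simp
    show "emeasure \<mu> (closure {x. f x \<noteq> 0}) < \<infinity>" using lf_measuresD(2)[OF \<mu>] CB_plusD(4)[OF f] .
    show "f \<in> borel_measurable \<mu>" using lf_measurable[OF \<mu>] CB_plusD(3)[OF f] .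
    show "AE x\<in>closure {x. f x \<noteq> 0} in \<mu>. norm (f x) \<le> c" using c CB_plusD(1)[OF f] by simp
    show "AE x in \<mu>. x \<notin> closure {x. f x \<noteq> 0} \<longrightarrow> f x = 0"
      using closure_subset[of "{x. f x \<noteq> 0}"] by (intro AE_I2) auto
  qed
qed

section \<open>Measurability of integrals of test functions\<close>

lemma space_lf_algebra: "space (lf_measure_algebra Bb) = \<M>"
  unfolding lf_measure_algebra_def by (rule space_measure_of) auto

lemma measurable_emeasure_lf:
  assumes "B \<in> Bb"
  shows "(\<lambda>\<mu>. emeasure \<mu> B) \<in> borel_measurable (lf_measure_algebra Bb)"
proof (rule measurableI)
  fix A :: "ennreal set" assume "A \<in> sets borel"
  then have "{\<mu> \<in> \<M>. emeasure \<mu> B \<in> A} \<in> sets (lf_measure_algebra Bb)"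
    unfolding lf_measure_algebra_def using assms by (intro in_measure_of) auto
  moreover have "(\<lambda>\<mu>. emeasure \<mu> B) -` A \<inter> space (lf_measure_algebra Bb) = {\<mu> \<in> \<M>. emeasure \<mu> B \<in> A}"
    by (auto simp: space_lf_algebra)
  ultimately show "(\<lambda>\<mu>. emeasure \<mu> B) -` A \<inter> space (lf_measure_algebra Bb) \<in> sets (lf_measure_algebra Bb)"
    by simp
qed simp

lemma lf_measurable_restrict:
  fixes u :: "'a \<Rightarrow> ennreal"
  assumes "\<mu> \<in> space (lf_measure_algebra Bb)" "u \<in> borel_measurable borel" "B \<in> Bb"
  shows "(\<lambda>x. u x * indicator B x) \<in> borel_measurable \<mu>"
proof -
  have [measurable]: "u \<in> borel_measurable borel" "B \<in> sets borel" using assms bounded_borel by auto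
  show ?thesis using assms(1) unfolding space_lf_algebra by (rule lf_measurable) measurable
qed

text \<open>The factor \<open>indicator B\<close> reduces the case of an indicator of
  \<open>A\<close> to the measure of the bounded set \<open>A \<inter> B\<close>, and evaluations at
  bounded sets generate the sigma-algebra. The general case follows by the usual induction over
  measurable functions.\<close>

lemma measurable_nn_integral_lf:
  assumes "u \<in> borel_measurable borel" and B: "B \<in> Bb"
  shows "(\<lambda>\<mu>. \<integral>\<^sup>+x. u x * indicator B x \<partial>\<mu>) \<in> borel_measurable (lf_measure_algebra Bb)"
  using assms(1)
proof (induction u rule: borel_measurable_induct)
  case (cong f g)
  then have "f = g" by auto
  with cong show ?case by simp
next
  case (set A)
  have "(\<lambda>\<mu>. emeasure \<mu> (A \<inter> B)) \<in> borel_measurable (lf_measure_algebra Bb)"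
    using set B bounded_borel by (intro measurable_emeasure_lf bounded_subset[OF _ B]) auto
  then show ?case
  proof (rule measurable_cong[THEN iffD1, rotated])
    fix \<mu> assume "\<mu> \<in> space (lf_measure_algebra Bb)"
    then have "A \<inter> B \<in> sets \<mu>" using set bounded_borel[OF B] lf_measuresD(1) space_lf_algebra by auto
    then show "emeasure \<mu> (A \<inter> B) = (\<integral>\<^sup>+x. indicator A x * indicator B x \<partial>\<mu>)"
      by (simp add: indicator_inter_arith[symmetric])
  qed
next
  case (mult u c)
  have "(\<lambda>\<mu>. c * (\<integral>\<^sup>+x. u x * indicator B x \<partial>\<mu>)) \<in> borel_measurable (lf_measure_algebra Bb)"
    using mult by simp
  then show ?case
  proof (rule measurable_cong[THEN iffD1, rotated])
    fix \<mu> assume "\<mu> \<in> space (lf_measure_algebra Bb)"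
    then have "(\<lambda>x. u x * indicator B x) \<in> borel_measurable \<mu>"
      using mult(2) B by (rule lf_measurable_restrict)
    then show "c * (\<integral>\<^sup>+x. u x * indicator B x \<partial>\<mu>) = (\<integral>\<^sup>+x. c * u x * indicator B x \<partial>\<mu>)"
      by (simp add: nn_integral_cmult[symmetric] mult.assoc)
  qed
next
  case (add u v)
  have "(\<lambda>\<mu>. (\<integral>\<^sup>+x. v x * indicator B x \<partial>\<mu>) + (\<integral>\<^sup>+x. u x * indicator B x \<partial>\<mu>))
      \<in> borel_measurable (lf_measure_algebra Bb)"
    using add by simp
  then show ?case
  proof (rule measurable_cong[THEN iffD1, rotated])
    fix \<mu> assume "\<mu> \<in> space (lf_measure_algebra Bb)"
    then have "(\<lambda>x. u x * indicator B x) \<in> borel_measurable \<mu>" "(\<lambda>x. v x * indicator B x) \<in> borel_measurable \<mu>"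
      using add by (auto intro: lf_measurable_restrict[OF _ _ B])
    then show "(\<integral>\<^sup>+x. v x * indicator B x \<partial>\<mu>) + (\<integral>\<^sup>+x. u x * indicator B x \<partial>\<mu>)
        = (\<integral>\<^sup>+x. (v x + u x) * indicator B x \<partial>\<mu>)"
      by (simp add: nn_integral_add[symmetric] distrib_right)
  qed
next
  case (seq U)
  have "(\<lambda>\<mu>. SUP i. \<integral>\<^sup>+x. U i x * indicator B x \<partial>\<mu>) \<in> borel_measurable (lf_measure_algebra Bb)"
    using seq by (intro borel_measurable_SUP) auto
  then show ?case
  proof (rule measurable_cong[THEN iffD1, rotated])
    fix \<mu> assume "\<mu> \<in> space (lf_measure_algebra Bb)"
    then have "(\<lambda>x. U i x * indicator B x) \<in> borel_measurable \<mu>" for i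
      using seq(1)[of i] B by (rule lf_measurable_restrict)
    moreover have "incseq (\<lambda>i x. U i x * indicator B x)"
      using seq(3) unfolding incseq_def le_fun_def by (meson mult_right_mono zero_le)
    ultimately have "(\<integral>\<^sup>+x. (SUP i. U i x * indicator B x) \<partial>\<mu>) = (SUP i. \<integral>\<^sup>+x. U i x * indicator B x \<partial>\<mu>)"
      by (intro nn_integral_monotone_convergence_SUP)
    moreover have "(SUP i. U i x * indicator B x) = (SUP i. U i) x * indicator B x" for x
      unfolding SUP_apply by (rule SUP_mult_right_ennreal[symmetric])
    ultimately show "(SUP i. \<integral>\<^sup>+x. U i x * indicator B x \<partial>\<mu>) = (\<integral>\<^sup>+x. (SUP i. U i) x * indicator B x \<partial>\<mu>)"
      by simp
  qed
qed

lemma measurable_integral_lf: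
  assumes f: "f \<in> CB_plus Bb"
  shows "(\<lambda>\<mu>. \<integral>x. f x \<partial>\<mu>) \<in> borel_measurable (lf_measure_algebra Bb)"
proof -
  define B where "B = closure {x. f x \<noteq> 0}"
  have "(\<lambda>\<mu>. enn2real (\<integral>\<^sup>+x. ennreal (f x) * indicator B x \<partial>\<mu>)) \<in> borel_measurable (lf_measure_algebra Bb)"
    using CB_plusD(3,4)[OF f] unfolding B_def
    by (intro measurable_compose[OF measurable_nn_integral_lf]) auto
  then show ?thesis
  proof (rule measurable_cong[THEN iffD1, rotated])
    fix \<mu> assume "\<mu> \<in> space (lf_measure_algebra Bb)"
    then have \<mu>: "\<mu> \<in> \<M>" by (simp add: space_lf_algebra)
    \<comment> \<open>Restricting to the closed support \<open>B\<close> changes nothing, as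
      \<open>f\<close> vanishes outside it.\<close>
    have eq: "ennreal (f x) * indicator B x = ennreal (f x)" for x
      using closure_subset[of "{x. f x \<noteq> 0}"] by (cases "f x = 0") (auto simp: B_def)
    show "enn2real (\<integral>\<^sup>+x. ennreal (f x) * indicator B x \<partial>\<mu>) = (\<integral>x. f x \<partial>\<mu>)"
      unfolding eq using CB_plusD(1)[OF f] lf_measurable[OF \<mu> CB_plusD(3)[OF f]]
      by (intro integral_eq_nn_integral[symmetric]) auto
  qed
qed

text \<open>This turns lower bounds into upper bounds: in
  \<open>\<mu>(g) = c \<mu>(h) - \<mu>(c h - g)\<close> the last integrand is again a test
  function.\<close>

lemma CB_plus_diff:
  assumes "h \<in> CB_plus Bb" "g \<in> CB_plus Bb" "0 \<le> c" "\<And>x. g x \<le> c * h x"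
  shows "(\<lambda>x. c * h x - g x) \<in> CB_plus Bb"
proof -
  obtain C where C: "\<And>x. h x \<le> C" using CB_plusD(5)[OF assms(1)] by blast
  have "\<bar>c * h x - g x\<bar> \<le> c * C" for x
    using assms(4)[of x] CB_plusD(1)[OF assms(2), of x] mult_left_mono[OF C assms(3), of x] by linarith
  then have "bounded (range (\<lambda>x. c * h x - g x))" by (auto simp: bounded_iff)
  moreover have "closure {x. c * h x - g x \<noteq> 0} \<in> Bb"
  proof (rule bounded_closure_subset)
    show "closure {x. h x \<noteq> 0} \<union> closure {x. g x \<noteq> 0} \<in> Bb"
      using assms CB_plusD(4) by (intro bounded_Un) auto
    show "{x. c * h x - g x \<noteq> 0} \<subseteq> closure {x. h x \<noteq> 0} \<union> closure {x. g x \<noteq> 0}"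
      using closure_subset[of "{x. h x \<noteq> 0}"] closure_subset[of "{x. g x \<noteq> 0}"] by fastforce
  qed
  moreover have "continuous_on UNIV (\<lambda>x. c * h x - g x)"
    using assms CB_plusD(2) by (intro continuous_intros) auto
  ultimately show ?thesis using assms(4) by (simp add: CB_plus_def)
qed

lemma topspace_vague: "topspace (vague_topology Bb) = \<M>"
  using topspace_vague_topology[OF boundedness bounded_nonempty] .

lemma continuous_map_vague_integral:
  assumes "f \<in> CB_plus Bb"
  shows "continuous_map (vague_topology Bb) euclideanreal (\<lambda>\<mu>. \<integral>x. f x \<partial>\<mu>)"
  unfolding continuous_map topspace_vague
proof (intro conjI allI impI)
  fix U :: "real set" assume "openin euclideanreal U"
  then show "openin (vague_topology Bb) {\<mu> \<in> \<M>. (\<integral>x. f x \<partial>\<mu>) \<in> U}"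
    unfolding vague_topology_def using assms by (intro topology_generated_by_Basis) auto
qed auto

end

section \<open>Lipschitz test functions\<close>

locale metrized_localizing_boundedness = localizing_boundedness Bb
  for Bb :: "'a::polish_space set set" +
  fixes d :: "'a metric"
  assumes mspace_UNIV: "mspace d = UNIV"
    and metrizes: "mtopology_of d = euclidean"
    and enlargement_bounded: "B \<in> Bb \<Longrightarrow> \<exists>\<epsilon>>0. enlargement d \<epsilon> B \<in> Bb"
begin

sublocale Metric_space UNIV "mdist d"
  using Metric_space_mspace_mdist[of d] by (simp add: mspace_UNIV)

lemma mtopology_euclidean: "mtopology = euclidean"
  using metrizes by (simp add: mtopology_of_def mspace_UNIV)

lemma LB_plus_iff:
  "f \<in> LB_plus Bb d \<longleftrightarrow> (\<forall>x. 0 \<le> f x) \<and> (\<exists>C. \<forall>x. f x \<le> C)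
     \<and> (\<exists>K. \<forall>x y. \<bar>f x - f y\<bar> \<le> K * mdist d x y) \<and> closure {x. f x \<noteq> 0} \<in> Bb"
proof -
  have "bounded (range f) \<longleftrightarrow> (\<exists>C. \<forall>x. f x \<le> C)" if "\<forall>x. 0 \<le> f x"
    using that by (simp add: bounded_iff)
  then show ?thesis
    by (auto simp: LB_plus_def Lipschitz_continuous_map_def mspace_UNIV dist_real_def)
qed

lemma LB_plus_subset_CB_plus:
  assumes "f \<in> LB_plus Bb d"
  shows "f \<in> CB_plus Bb"
proof -
  have "continuous_map (mtopology_of d) (mtopology_of euclidean_metric) f"
    using assms unfolding LB_plus_def by (blast intro: Lipschitz_continuous_imp_continuous_map)
  then have "continuous_on UNIV f"
    by (simp add: metrizes)
  with assms show ?thesis by (simp add: LB_plus_def CB_plus_def)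
qed

lemma LB_plus_zero: "(\<lambda>_. 0) \<in> LB_plus Bb d"
  using bounded_empty by (auto simp: LB_plus_iff intro: exI[of _ 0])

text \<open>A common argument for sum and maximum. Nonnegativity together with
  \<open>op a b \<le> a + b\<close> forces \<open>op 0 0 = 0\<close>, so the result is supported in
  the union of the two supports; the last premise adds up the Lipschitz constants.\<close>

lemma LB_plus_combine:
  fixes op :: "real \<Rightarrow> real \<Rightarrow> real"
  assumes f: "f \<in> LB_plus Bb d" and g: "g \<in> LB_plus Bb d"
    and op: "\<And>a b. 0 \<le> a \<Longrightarrow> 0 \<le> b \<Longrightarrow> 0 \<le> op a b" "\<And>a b. 0 \<le> a \<Longrightarrow> 0 \<le> b \<Longrightarrow> op a b \<le> a + b"
      "\<And>a b a' b'. \<bar>op a b - op a' b'\<bar> \<le> \<bar>a - a'\<bar> + \<bar>b - b'\<bar>"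
  shows "(\<lambda>x. op (f x) (g x)) \<in> LB_plus Bb d"
proof -
  note fD = f[unfolded LB_plus_iff] and gD = g[unfolded LB_plus_iff]
  obtain C D where C: "\<And>x. f x \<le> C" "\<And>x. g x \<le> D" using fD gD by blast
  obtain K L where K: "\<And>x y. \<bar>f x - f y\<bar> \<le> K * mdist d x y" "\<And>x y. \<bar>g x - g y\<bar> \<le> L * mdist d x y"
    using fD gD by blast
  have nn: "0 \<le> f x" "0 \<le> g x" for x using fD gD by auto
  have "op (f x) (g x) \<le> C + D" for x
    using op(2)[OF nn, of x x] C[of x] by linarith
  moreover have "\<bar>op (f x) (g x) - op (f y) (g y)\<bar> \<le> (K + L) * mdist d x y" for x y
    using op(3)[of "f x" "g x" "f y" "g y"] K(1)[of x y] K(2)[of x y] by (simp add: distrib_right)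
  moreover have "closure {x. op (f x) (g x) \<noteq> 0} \<in> Bb"
  proof (rule bounded_closure_subset)
    show "closure {x. f x \<noteq> 0} \<union> closure {x. g x \<noteq> 0} \<in> Bb"
      using fD gD by (intro bounded_Un) auto
    have "op 0 0 = 0" using op(1,2)[of 0 0] by simp
    then have "{x. op (f x) (g x) \<noteq> 0} \<subseteq> {x. f x \<noteq> 0} \<union> {x. g x \<noteq> 0}" by auto
    also have "\<dots> \<subseteq> closure {x. f x \<noteq> 0} \<union> closure {x. g x \<noteq> 0}"
      by (intro Un_mono closure_subset)
    finally show "{x. op (f x) (g x) \<noteq> 0} \<subseteq> closure {x. f x \<noteq> 0} \<union> closure {x. g x \<noteq> 0}" .
  qed
  moreover have "0 \<le> op (f x) (g x)" for x using op(1) nn by blast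
  ultimately show ?thesis unfolding LB_plus_iff by blast
qed

lemma LB_plus_add: "f \<in> LB_plus Bb d \<Longrightarrow> g \<in> LB_plus Bb d \<Longrightarrow> (\<lambda>x. f x + g x) \<in> LB_plus Bb d"
  by (rule LB_plus_combine[where op = "(+)"]) (assumption | linarith)+

lemma LB_plus_max: "f \<in> LB_plus Bb d \<Longrightarrow> g \<in> LB_plus Bb d \<Longrightarrow> (\<lambda>x. max (f x) (g x)) \<in> LB_plus Bb d"
  by (rule LB_plus_combine[where op = max]) (assumption | linarith)+

text \<open>Distance to \<open>z\<close>, positive part and truncation at \<open>q\<close> are all
  1-Lipschitz, so the constant is the slope \<open>n\<close>. The support is bounded as soon as the
  open ball on which the cone is positive lies in a bounded set.\<close>

lemma LB_plus_cone:
  assumes "0 < q" "{x. 0 < r - mdist d z x} \<subseteq> B" "B \<in> Bb"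
  shows "(\<lambda>x. min q (real n * max 0 (r - mdist d z x))) \<in> LB_plus Bb d"
  unfolding LB_plus_iff
proof (intro conjI allI)
  show "\<exists>C. \<forall>x. min q (real n * max 0 (r - mdist d z x)) \<le> C" by (intro exI[of _ q]) simp
  have "\<bar>min q (real n * max 0 (r - mdist d z x)) - min q (real n * max 0 (r - mdist d z y))\<bar> \<le> real n * mdist d x y" for x y
  proof -
    have "\<bar>min q (real n * max 0 (r - mdist d z x)) - min q (real n * max 0 (r - mdist d z y))\<bar>
        \<le> \<bar>real n * max 0 (r - mdist d z x) - real n * max 0 (r - mdist d z y)\<bar>" by linarith
    also have "\<dots> = real n * \<bar>max 0 (r - mdist d z x) - max 0 (r - mdist d z y)\<bar>"
      by (simp add: abs_mult flip: right_diff_distrib)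
    also have "\<dots> \<le> real n * mdist d x y"
      using triangle[of z x y] triangle[of z y x] commute[of x y] by (intro mult_left_mono) auto
    finally show ?thesis .
  qed
  then show "\<exists>K. \<forall>x y. \<bar>min q (real n * max 0 (r - mdist d z x)) - min q (real n * max 0 (r - mdist d z y))\<bar> \<le> K * mdist d x y"
    by blast
  show "closure {x. min q (real n * max 0 (r - mdist d z x)) \<noteq> 0} \<in> Bb"
  proof (rule bounded_closure_subset[OF _ assms(3)])
    have "{x. min q (real n * max 0 (r - mdist d z x)) \<noteq> 0} \<subseteq> {x. 0 < r - mdist d z x}"
      using assms(1) by (auto simp: max_def min_def split: if_splits)
    then show "{x. min q (real n * max 0 (r - mdist d z x)) \<noteq> 0} \<subseteq> B" using assms(2) by blast
  qed
  show "0 \<le> min q (real n * max 0 (r - mdist d z x))" for x using assms(1) by simp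
qed

text \<open>The witness is the positive part of \<open>1 - d(x, B) / e\<close>, with Lipschitz
  constant \<open>1 / e\<close>. It is positive only within distance \<open>e\<close> of
  \<open>B\<close>, so its support is bounded because the enlargement of \<open>B\<close>
  is.\<close>

lemma LB_plus_dominates:
  assumes "B \<in> Bb"
  obtains h where "h \<in> LB_plus Bb d" "\<And>x. x \<in> B \<Longrightarrow> 1 \<le> h x"
proof -
  obtain e where e: "e > 0" "enlargement d e B \<in> Bb" using enlargement_bounded[OF assms] by blast
  \<comment> \<open>The distance is an infimum, hence the formula becomes a supremum over
    \<open>B\<close>. Inserting 0 produces the positive part and gives the value 0 when
    \<open>B\<close> is empty.\<close>
  define A where "A = (\<lambda>x. insert 0 ((\<lambda>z. 1 - mdist d x z / e) ` B))"
  define h where "h = (\<lambda>x. Sup (A x))"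
  have A1: "a \<le> 1" if "a \<in> A x" for a x using that e(1) by (auto simp: A_def)
  have bdd: "bdd_above (A x)" for x using A1 by (rule bdd_aboveI)
  have ne: "A x \<noteq> {}" for x by (simp add: A_def)
  have h_upper: "a \<le> h x" if "a \<in> A x" for a x
    unfolding h_def using that bdd by (rule cSup_upper)
  have nn: "0 \<le> h x" for x by (rule h_upper) (simp add: A_def)
  have h1: "h x \<le> 1" for x unfolding h_def using ne A1 by (rule cSup_least)
  have lip: "h x \<le> h y + 1 / e * mdist d x y" for x y
    unfolding h_def[THEN fun_cong, of x]
  proof (rule cSup_least[OF ne])
    fix a assume "a \<in> A x"
    then consider "a = 0" | z where "z \<in> B" "a = 1 - mdist d x z / e" by (auto simp: A_def)
    then show "a \<le> h y + 1 / e * mdist d x y"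
    proof cases
      case 1
      then show ?thesis using nn[of y] e(1) by simp
    next
      case 2
      then have "1 - mdist d y z / e \<le> h y" by (intro h_upper) (auto simp: A_def)
      moreover have "mdist d y z / e \<le> mdist d x z / e + 1 / e * mdist d x y"
        using triangle[of y x z] commute[of x y] e(1) by (simp add: field_simps)
      ultimately show ?thesis using 2(2) by linarith
    qed
  qed
  have "h \<in> LB_plus Bb d"
    unfolding LB_plus_iff
  proof (intro conjI)
    have "\<bar>h x - h y\<bar> \<le> 1 / e * mdist d x y" for x y
      using lip[of x y] lip[of y x] commute[of x y] by simp
    then show "\<exists>K. \<forall>x y. \<bar>h x - h y\<bar> \<le> K * mdist d x y" by blast
    show "closure {x. h x \<noteq> 0} \<in> Bb"
    proof (rule bounded_closure_subset[OF _ e(2)], rule subsetI, clarify)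
      fix x assume "h x \<noteq> 0"
      then have "0 < Sup (A x)" using nn[of x] by (simp add: h_def)
      then obtain a where "a \<in> A x" "0 < a" using less_cSup_iff[OF ne bdd] by blast
      then obtain z where z: "z \<in> B" "mdist d x z < e" using e(1) by (auto simp: A_def field_simps)
      have "set_dist d x B \<le> ennreal (mdist d x z)" unfolding set_dist_def using z(1) by (rule INF_lower)
      also have "\<dots> \<le> ennreal e" using z(2) by (intro ennreal_leI) simp
      finally show "x \<in> enlargement d e B" by (simp add: enlargement_def mspace_UNIV)
    qed
  qed (use nn h1 in auto)
  moreover have "1 \<le> h x" if "x \<in> B" for x
    using that by (intro h_upper) (force simp: A_def)
  ultimately show thesis by (rule that)
qed

text \<open>One countable family serves all \<open>g\<close> at once: finite maxima of truncated
  cones with rational parameters and centres in a countable dense set.\<close>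

lemma countable_LB_plus_approximation:
  obtains L where "countable L" "L \<subseteq> LB_plus Bb d"
    "\<And>g. g \<in> CB_plus Bb \<Longrightarrow> \<exists>h. (\<forall>n. h n \<in> L) \<and> (\<forall>n x. h n x \<le> g x) \<and> (\<forall>x. (\<lambda>n. h n x) \<longlonglongrightarrow> g x)"
proof -
  note result = that
  obtain D :: "'a set" where D: "countable D" "\<And>X. open X \<Longrightarrow> X \<noteq> {} \<Longrightarrow> \<exists>x\<in>D. x \<in> X"
    using countable_dense_exists by metis
  define cone where "cone = (\<lambda>(z, r) x. max 0 (r - mdist d z x))"
  define G where "G = cone ` (D \<times> \<rat>)"
  define tents where "tents = (\<lambda>(q, n, m) x. min q (real n * m x)) ` (\<rat> \<times> UNIV \<times> G)"
  define maxs where "maxs = (\<lambda>l (x::'a). foldr (\<lambda>f z. max (f x) z) l (0::real))"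
  \<comment> \<open>Cones may have unbounded support, and the intersection removes the maxima that
    fail to be test functions. For a given \<open>g\<close>, the cones positive only where
    \<open>g\<close> is positive survive.\<close>
  define L where "L = maxs ` lists tents \<inter> LB_plus Bb d"
  have cG: "countable G" unfolding G_def
    using D(1) countable_rat by (intro countable_image countable_SIGMA)
  then have "countable L" unfolding L_def tents_def
    by (intro countable_Int1 countable_image countable_lists countable_SIGMA countable_rat) auto
  moreover have "L \<subseteq> LB_plus Bb d" by (simp add: L_def)
  moreover have "\<exists>h. (\<forall>n. h n \<in> L) \<and> (\<forall>n x. h n x \<le> g x) \<and> (\<forall>x. (\<lambda>n. h n x) \<longlonglongrightarrow> g x)"
    if g: "g \<in> CB_plus Bb" for g
  proof (rule increasing_lattice_approximation[of G UNIV g L])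
    show "countable G" by fact
    show "0 \<le> m x" if "m \<in> G" for m x using that by (auto simp: G_def cone_def)
    show "0 \<le> g x" for x using CB_plusD(1)[OF g] .
    have "(\<lambda>_. 0) = maxs []" "[] \<in> lists tents" by (auto simp: maxs_def)
    then show "(\<lambda>_. 0) \<in> L" unfolding L_def using LB_plus_zero by blast
    show "(\<lambda>x. max (u x) (v x)) \<in> L" if uv: "u \<in> L" "v \<in> L" for u v
    proof -
      from uv obtain k l where kl: "k \<in> lists tents" "u = maxs k" "l \<in> lists tents" "v = maxs l"
        by (auto simp: L_def)
      \<comment> \<open>The fold starts at 0, so \<open>maxs\<close> is nonnegative and appending
        lists corresponds to the pointwise maximum, also when a list is empty.\<close>
      have "0 \<le> maxs l x" for l x by (induction l) (auto simp: maxs_def)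
      then have "max (maxs k x) (maxs l x) = maxs (k @ l) x" for x
        by (induction k) (auto simp: maxs_def max.assoc)
      then have "(\<lambda>x. max (u x) (v x)) = maxs (k @ l)" using kl by auto
      moreover have "k @ l \<in> lists tents" using kl by auto
      moreover have "(\<lambda>x. max (u x) (v x)) \<in> LB_plus Bb d"
        using uv unfolding L_def by (intro LB_plus_max) blast+
      ultimately show ?thesis unfolding L_def by blast
    qed
    show "(\<lambda>x. min q (real n * m x)) \<in> L"
      if m: "m \<in> G" and q: "q \<in> \<rat>" "q > 0" and supp: "\<And>x. x \<in> UNIV \<Longrightarrow> m x > 0 \<Longrightarrow> g x > 0" for m q n
    proof -
      obtain z r where zr: "m = (\<lambda>x. max 0 (r - mdist d z x))" using m by (auto simp: G_def cone_def)
      have "0 < g x" if "0 < r - mdist d z x" for x using that supp[of x] by (simp add: zr)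
      then have "{x. 0 < r - mdist d z x} \<subseteq> {x. g x \<noteq> 0}" by force
      also note closure_subset
      finally have "(\<lambda>x. min q (real n * m x)) \<in> LB_plus Bb d"
        unfolding zr using q(2) CB_plusD(4)[OF g] by (intro LB_plus_cone)
      moreover have "(\<lambda>x. min q (real n * m x)) = maxs [\<lambda>x. min q (real n * m x)]"
        using q(2) by (auto simp: maxs_def zr)
      moreover have "(\<lambda>x. min q (real n * m x)) \<in> tents"
        unfolding tents_def using q(1) m by force
      ultimately show ?thesis unfolding L_def by auto
    qed
    show "\<exists>m\<in>G. m x > 0 \<and> (\<forall>y\<in>UNIV. m y > 0 \<longrightarrow> q < g y)" if q: "q < g x" for x q
    proof -
      have "open {y. q < g y}"
        using CB_plusD(2)[OF g] by (intro open_Collect_less continuous_intros)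
      then have "openin mtopology {y. q < g y}" by (simp add: mtopology_euclidean)
      then obtain e where e: "e > 0" "mball x e \<subseteq> {y. q < g y}"
        using q unfolding openin_mtopology by blast
      \<comment> \<open>A centre \<open>z\<close> within \<open>r\<close> of \<open>x\<close> has
        \<open>x\<close> in its own \<open>r\<close>-ball, and this ball stays within
        \<open>2 * r < e\<close> of \<open>x\<close>.\<close>
      obtain r where r: "r \<in> \<rat>" "0 < r" "r < e / 2" using Rats_dense_in_real[of 0 "e / 2"] e(1) by auto
      have "open (mball x r)" using openin_mball[of x r] by (simp add: mtopology_euclidean)
      moreover have "mball x r \<noteq> {}" using r(2) by auto
      ultimately have "\<exists>z\<in>D. z \<in> mball x r" by (rule D(2))
      then obtain z where z: "z \<in> D" "mdist d x z < r" by auto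
      have "cone (z, r) \<in> G" using z(1) r(1) by (auto simp: G_def)
      moreover have "0 < cone (z, r) x" using z(2) commute[of x z] by (simp add: cone_def)
      moreover have "q < g y" if "0 < cone (z, r) y" for y
      proof -
        have "mdist d z y < r" using that by (simp add: cone_def)
        then have "mdist d x y < e" using triangle[of x z y] z(2) r(3) by simp
        then show ?thesis using e(2) by auto
      qed
      ultimately show ?thesis by blast
    qed
  qed blast
  ultimately show thesis by (rule result)
qed

section \<open>Laplace functionals and the vague topology\<close>

abbreviation exp_integral :: "('a \<Rightarrow> real) \<Rightarrow> 'a measure \<Rightarrow> real" where
  "exp_integral f \<mu> \<equiv> exp (- (\<integral>x. f x \<partial>\<mu>))"

text \<open>Integration of a test function is continuous for the topology generated by countably
  many Laplace functionals: lower semicontinuity comes from the approximation from below, upper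
  semicontinuity from passing to the complement in a dominating Lipschitz function.\<close>

lemma vague_topology_countably_generated:
  obtains F where "countable F" "F \<subseteq> LB_plus Bb d"
    "\<And>U \<nu>. openin (vague_topology Bb) U \<Longrightarrow> \<nu> \<in> U \<Longrightarrow>
      \<exists>I \<delta>. finite I \<and> I \<subseteq> exp_integral ` F \<and> \<delta> > 0
        \<and> (\<forall>\<mu>\<in>\<M>. (\<forall>v\<in>I. \<bar>v \<mu> - v \<nu>\<bar> < \<delta>) \<longrightarrow> \<mu> \<in> U)"
proof -
  note result = that
  obtain L where L: "countable L" "L \<subseteq> LB_plus Bb d"
    "\<And>g. g \<in> CB_plus Bb \<Longrightarrow> \<exists>h. (\<forall>n. h n \<in> L) \<and> (\<forall>n x. h n x \<le> g x) \<and> (\<forall>x. (\<lambda>n. h n x) \<longlonglongrightarrow> g x)"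
    using countable_LB_plus_approximation by metis
  obtain Cb where Cb: "countable Cb" "Cb \<subseteq> Bb" "\<And>B. B \<in> Bb \<Longrightarrow> \<exists>C\<in>Cb. B \<subseteq> C"
    using countable_basis_bounded by metis
  have "\<exists>h\<in>LB_plus Bb d. \<forall>x\<in>C. 1 \<le> h x" if "C \<in> Cb" for C
    using LB_plus_dominates Cb(2) that by (metis subsetD)
  then obtain H where H: "\<And>C. C \<in> Cb \<Longrightarrow> H C \<in> LB_plus Bb d" "\<And>C x. C \<in> Cb \<Longrightarrow> x \<in> C \<Longrightarrow> 1 \<le> H C x"
    by metis
  \<comment> \<open>\<open>L\<close> provides the lower bounds; one dominating function for each
    member of a countable basis provides the upper bounds.\<close>
  define F where "F = L \<union> H ` Cb"
  define w :: "('a \<Rightarrow> real) \<Rightarrow> 'a measure \<Rightarrow> real" where "w = exp_integral"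
  \<comment> \<open>\<open>nbhd U \<nu>\<close> says that, among locally finite measures,
    \<open>U\<close> is a neighbourhood of \<open>\<nu>\<close> for the topology generated by the
    functionals of \<open>F\<close>.\<close>
  define nbhd where "nbhd = (\<lambda>U \<nu>. \<exists>I \<delta>. finite I \<and> I \<subseteq> w ` F \<and> \<delta> > 0
    \<and> (\<forall>\<mu>\<in>\<M>. (\<forall>v\<in>I. \<bar>v \<mu> - v \<nu>\<bar> < \<delta>) \<longrightarrow> \<mu> \<in> U))"
  have nbhd_Int: "nbhd (U \<inter> V) \<nu>" if "nbhd U \<nu>" "nbhd V \<nu>" for U V \<nu>
  proof -
    from that obtain I J \<delta> \<gamma> where "finite I" "I \<subseteq> w ` F" "\<delta> > 0" "finite J" "J \<subseteq> w ` F" "\<gamma> > 0"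
      "\<forall>\<mu>\<in>\<M>. (\<forall>v\<in>I. \<bar>v \<mu> - v \<nu>\<bar> < \<delta>) \<longrightarrow> \<mu> \<in> U" "\<forall>\<mu>\<in>\<M>. (\<forall>v\<in>J. \<bar>v \<mu> - v \<nu>\<bar> < \<gamma>) \<longrightarrow> \<mu> \<in> V"
      unfolding nbhd_def by metis
    then show ?thesis
      unfolding nbhd_def by (intro exI[of _ "I \<union> J"] exI[of _ "min \<delta> \<gamma>"]) auto
  qed
  have nbhd_mono: "nbhd V \<nu>" if "nbhd U \<nu>" "U \<inter> \<M> \<subseteq> V" for U V \<nu>
    using that unfolding nbhd_def by (meson IntI subsetD)
  have lower: "nbhd {\<mu>. a < (\<integral>x. g x \<partial>\<mu>)} \<nu>"
    if g: "g \<in> CB_plus Bb" and \<nu>: "\<nu> \<in> \<M>" and a: "a < (\<integral>x. g x \<partial>\<nu>)" for g a \<nu>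
  proof -
    obtain h where h: "\<And>n. h n \<in> L" "\<And>n x. h n x \<le> g x" "\<And>x. (\<lambda>n. h n x) \<longlonglongrightarrow> g x"
      using L(3)[OF g] by blast
    have hCB: "h n \<in> CB_plus Bb" for n using h(1) L(2) LB_plus_subset_CB_plus by blast
    have "(\<lambda>n. \<integral>x. h n x \<partial>\<nu>) \<longlonglongrightarrow> (\<integral>x. g x \<partial>\<nu>)"
    proof (rule integral_dominated_convergence[where w = g])
      show "integrable \<nu> g" using g \<nu> by (rule CB_plus_integrable)
      then show "g \<in> borel_measurable \<nu>" by simp
      show "h n \<in> borel_measurable \<nu>" for n using CB_plus_integrable[OF hCB \<nu>] by simp
    qed (use h(2,3) CB_plusD(1)[OF hCB] in auto)
    from order_tendstoD(1)[OF this a] obtain n where n: "a < (\<integral>x. h n x \<partial>\<nu>)"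
      using eventually_happens'[OF sequentially_bot] by blast
    show ?thesis
      unfolding nbhd_def
    proof (intro exI conjI ballI impI)
      show "{w (h n)} \<subseteq> w ` F" using h(1) by (auto simp: F_def)
      \<comment> \<open>As \<open>exp (- t)\<close> decreases in \<open>t\<close>, the bound
        \<open>a < \<mu>(h n)\<close> means \<open>w (h n) \<mu> < exp (- a)\<close>; the radius is
        the gap that \<open>\<nu>\<close> leaves there.\<close>
      show "0 < exp (- a) - w (h n) \<nu>" using n by (simp add: w_def)
      fix \<mu> assume \<mu>: "\<mu> \<in> \<M>" and "\<forall>v\<in>{w (h n)}. \<bar>v \<mu> - v \<nu>\<bar> < exp (- a) - w (h n) \<nu>"
      then have "w (h n) \<mu> < exp (- a)" by auto
      then have "a < (\<integral>x. h n x \<partial>\<mu>)" by (simp add: w_def)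
      also have "\<dots> \<le> (\<integral>x. g x \<partial>\<mu>)"
        using CB_plus_integrable[OF hCB \<mu>] CB_plus_integrable[OF g \<mu>] h(2) by (rule integral_mono)
      finally show "\<mu> \<in> {\<mu>. a < (\<integral>x. g x \<partial>\<mu>)}" by simp
    qed simp
  qed
  have upper_F: "nbhd {\<mu>. (\<integral>x. f x \<partial>\<mu>) < b} \<nu>" if f: "f \<in> F" and b: "(\<integral>x. f x \<partial>\<nu>) < b" for f b \<nu>
    unfolding nbhd_def
  proof (intro exI conjI ballI impI)
    show "{w f} \<subseteq> w ` F" using f by simp
    show "0 < w f \<nu> - exp (- b)" using b by (simp add: w_def)
    fix \<mu> assume "\<forall>v\<in>{w f}. \<bar>v \<mu> - v \<nu>\<bar> < w f \<nu> - exp (- b)"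
    then have "exp (- b) < w f \<mu>" by auto
    then show "\<mu> \<in> {\<mu>. (\<integral>x. f x \<partial>\<mu>) < b}" by (simp add: w_def)
  qed simp
  have upper: "nbhd {\<mu>. (\<integral>x. g x \<partial>\<mu>) < b} \<nu>"
    if g: "g \<in> CB_plus Bb" and \<nu>: "\<nu> \<in> \<M>" and b: "(\<integral>x. g x \<partial>\<nu>) < b" for g b \<nu>
  proof -
    obtain c where c: "c > 0" "\<And>x. g x \<le> c" using CB_plusD(5)[OF g] by blast
    obtain C where C: "C \<in> Cb" "closure {x. g x \<noteq> 0} \<subseteq> C" using Cb(3) CB_plusD(4)[OF g] by blast
    define h where "h = H C"
    have h: "h \<in> F" "h \<in> CB_plus Bb"
      using C(1) H(1) LB_plus_subset_CB_plus by (auto simp: h_def F_def)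
    have le: "g x \<le> c * h x" for x
    proof (cases "g x = 0")
      case True
      then show ?thesis using c(1) CB_plusD(1)[OF h(2), of x] by simp
    next
      case False
      then have "1 \<le> h x"
        unfolding h_def using C closure_subset[of "{x. g x \<noteq> 0}"] by (intro H(2)) auto
      then have "c * 1 \<le> c * h x" using c(1) by (intro mult_left_mono) auto
      with c(2)[of x] show ?thesis by linarith
    qed
    have k: "(\<lambda>x. c * h x - g x) \<in> CB_plus Bb"
      using CB_plus_diff[OF h(2) g] c(1) le by simp
    have int: "(\<integral>x. c * h x - g x \<partial>\<mu>) = c * (\<integral>x. h x \<partial>\<mu>) - (\<integral>x. g x \<partial>\<mu>)" if "\<mu> \<in> \<M>" for \<mu>
      using CB_plus_integrable[OF h(2) that] CB_plus_integrable[OF g that] by simp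
    \<comment> \<open>Half of the gap is spent on \<open>\<mu>(c h - g)\<close> and half on
      \<open>c \<mu>(h)\<close>; the latter becomes a tolerance of \<open>\<eta> / c\<close> for
      \<open>\<mu>(h)\<close>.\<close>
    define \<eta> where "\<eta> = (b - (\<integral>x. g x \<partial>\<nu>)) / 2"
    have \<eta>: "\<eta> > 0" "b = (\<integral>x. g x \<partial>\<nu>) + 2 * \<eta>" using b by (auto simp: \<eta>_def field_simps)
    have "nbhd {\<mu>. (\<integral>x. c * h x - g x \<partial>\<nu>) - \<eta> < (\<integral>x. c * h x - g x \<partial>\<mu>)} \<nu>"
      using \<eta>(1) by (intro lower k \<nu>) simp
    moreover have "nbhd {\<mu>. (\<integral>x. h x \<partial>\<mu>) < (\<integral>x. h x \<partial>\<nu>) + \<eta> / c} \<nu>"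
      using \<eta>(1) c(1) by (intro upper_F h(1)) simp
    ultimately show ?thesis
    proof (rule nbhd_mono[OF nbhd_Int], safe)
      fix \<mu> assume \<mu>: "\<mu> \<in> \<M>" and k\<mu>: "(\<integral>x. c * h x - g x \<partial>\<nu>) - \<eta> < (\<integral>x. c * h x - g x \<partial>\<mu>)"
        and "(\<integral>x. h x \<partial>\<mu>) < (\<integral>x. h x \<partial>\<nu>) + \<eta> / c"
      then have "c * (\<integral>x. h x \<partial>\<mu>) < c * (\<integral>x. h x \<partial>\<nu>) + \<eta>"
        using c(1) by (simp add: field_simps)
      then show "(\<integral>x. g x \<partial>\<mu>) < b"
        using k\<mu> \<eta>(2) unfolding int[OF \<mu>] int[OF \<nu>] by linarith
    qed
  qed
  \<comment> \<open>Induction over the generation of vaguely open sets. A subbasic set contains the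
    measures whose integral of \<open>f\<close> lies in an open interval around its value at
    \<open>\<nu>\<close>, so one lower and one upper bound suffice.\<close>
  have "nbhd U \<nu>" if "generate_topology_on {{\<mu> \<in> \<M>. (\<integral>x. f x \<partial>\<mu>) \<in> U} | f U. f \<in> CB_plus Bb \<and> open U} U" "\<nu> \<in> U" for U \<nu>
    using that
  proof (induction rule: generate_topology_on.induct)
    case (Int U V)
    then show ?case by (intro nbhd_Int) simp_all
  next
    case (UN K)
    from UN.prems obtain k where k: "k \<in> K" "\<nu> \<in> k" by (rule UnionE)
    then have "nbhd k \<nu>" by (rule UN.IH)
    moreover have "k \<inter> \<M> \<subseteq> \<Union>K" using k(1) by auto
    ultimately show ?case by (rule nbhd_mono)
  next
    case (Basis U)
    then obtain f V where V: "U = {\<mu> \<in> \<M>. (\<integral>x. f x \<partial>\<mu>) \<in> V}" "f \<in> CB_plus Bb" "open V" by blast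
    with Basis have \<nu>: "\<nu> \<in> \<M>" "(\<integral>x. f x \<partial>\<nu>) \<in> V" by auto
    obtain e where e: "e > 0" "ball (\<integral>x. f x \<partial>\<nu>) e \<subseteq> V" using openE[OF V(3) \<nu>(2)] by blast
    have "nbhd {\<mu>. (\<integral>x. f x \<partial>\<nu>) - e < (\<integral>x. f x \<partial>\<mu>)} \<nu>" "nbhd {\<mu>. (\<integral>x. f x \<partial>\<mu>) < (\<integral>x. f x \<partial>\<nu>) + e} \<nu>"
      using e(1) by (intro lower upper V(2) \<nu>(1); simp)+
    then show ?case
    proof (rule nbhd_mono[OF nbhd_Int], safe)
      fix \<mu> assume "\<mu> \<in> \<M>" "(\<integral>x. f x \<partial>\<nu>) - e < (\<integral>x. f x \<partial>\<mu>)" "(\<integral>x. f x \<partial>\<mu>) < (\<integral>x. f x \<partial>\<nu>) + e"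
      then show "\<mu> \<in> U" using e(2) unfolding V(1) by (auto simp: dist_real_def subset_iff)
    qed
  qed simp
  moreover have "countable F" "F \<subseteq> LB_plus Bb d"
    using L(1,2) Cb(1) H(1) by (auto simp: F_def)
  ultimately show thesis
    unfolding nbhd_def w_def by (intro result[of F]) (simp_all add: vague_topology_def openin_topology_generated_by_iff)
qed

text \<open>The integral of a nonnegative function is nonnegative for every \<open>\<mu>\<close>,
  its default value 0 in the nonintegrable case included.\<close>

lemma exp_integral_bounded:
  assumes "f \<in> LB_plus Bb d"
  shows "\<bar>exp_integral f \<mu>\<bar> \<le> 1"
  using CB_plusD(1)[OF LB_plus_subset_CB_plus[OF assms]] by simp

text \<open>The product of the functionals of \<open>f\<close> and \<open>g\<close> is the
  functional of \<open>f + g\<close>, and Lipschitz test functions are closed under addition. The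
  constant 1 belongs to \<open>f = 0\<close>.\<close>

sublocale laplace: multiplicative_class "lf_measure_algebra Bb" "exp_integral ` LB_plus Bb d"
proof
  fix w assume "w \<in> exp_integral ` LB_plus Bb d"
  then obtain f where f: "f \<in> LB_plus Bb d" "w = exp_integral f" by (rule imageE)
  show "w \<in> borel_measurable (lf_measure_algebra Bb)"
    unfolding f(2) using measurable_integral_lf[OF LB_plus_subset_CB_plus[OF f(1)]] by measurable
  show "\<exists>c. \<forall>\<mu>\<in>space (lf_measure_algebra Bb). \<bar>w \<mu>\<bar> \<le> c"
    unfolding f(2) by (intro exI[of _ 1] ballI exp_integral_bounded[OF f(1)])
  fix v assume "v \<in> exp_integral ` LB_plus Bb d"
  then obtain g where g: "g \<in> LB_plus Bb d" "v = exp_integral g" by (rule imageE)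
  show "\<exists>u\<in>exp_integral ` LB_plus Bb d. \<forall>\<mu>\<in>space (lf_measure_algebra Bb). v \<mu> * w \<mu> = u \<mu>"
  proof (rule bexI[of _ "exp_integral (\<lambda>x. g x + f x)"], rule ballI)
    fix \<mu> assume "\<mu> \<in> space (lf_measure_algebra Bb)"
    then have "integrable \<mu> f" "integrable \<mu> g"
      using f(1) g(1) by (auto simp: space_lf_algebra intro: CB_plus_integrable LB_plus_subset_CB_plus)
    then show "v \<mu> * w \<mu> = exp_integral (\<lambda>x. g x + f x) \<mu>"
      by (simp add: f(2) g(2) flip: exp_add)
  next
    show "exp_integral (\<lambda>x. g x + f x) \<in> exp_integral ` LB_plus Bb d"
      by (rule imageI[OF LB_plus_add[OF g(1) f(1)]])
  qed
next
  have "exp_integral (\<lambda>_. 0) \<in> exp_integral ` LB_plus Bb d"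
    by (rule imageI[OF LB_plus_zero])
  then show "(\<lambda>_. 1) \<in> exp_integral ` LB_plus Bb d" by simp
qed

end

theorem proposition4p1:
  fixes Bb :: "'a::polish_space set set"
    and d :: "'a metric"
    and P :: "nat \<Rightarrow> 'b measure" and N :: "nat \<Rightarrow> 'b \<Rightarrow> 'a measure"
    and P\<^sub>0 :: "'c measure" and N\<^sub>0 :: "'c \<Rightarrow> 'a measure"
  assumes "boundedness Bb"
    and "properly_localizes Bb"
    and "random_measure Bb P\<^sub>0 N\<^sub>0"
    and "\<And>n. random_measure Bb (P n) (N n)"
    and "mspace d = UNIV"
    and "mtopology_of d = euclidean"
    and "\<And>B. B \<in> Bb \<Longrightarrow> \<exists>\<epsilon>>0. enlargement d \<epsilon> B \<in> Bb"
  shows "converges_in_distribution (vague_topology Bb) P N P\<^sub>0 N\<^sub>0 \<longleftrightarrow>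
    (\<forall>f\<in>LB_plus Bb d.
      (\<lambda>n. \<integral>\<omega>. exp (- (\<integral>x. f x \<partial>N n \<omega>)) \<partial>P n)
        \<longlonglongrightarrow> (\<integral>\<omega>. exp (- (\<integral>x. f x \<partial>N\<^sub>0 \<omega>)) \<partial>P\<^sub>0))"
proof -
  interpret metrized_localizing_boundedness Bb d
    using assms by unfold_locales auto
  show ?thesis
  proof (intro iffI ballI)
    \<comment> \<open>Here \<open>\<mu> \<mapsto> exp (- \<mu>(f))\<close> is itself a bounded
      vaguely continuous function.\<close>
    fix f assume conv: "converges_in_distribution (vague_topology Bb) P N P\<^sub>0 N\<^sub>0" and f: "f \<in> LB_plus Bb d"
    have "continuous_map euclideanreal euclideanreal (\<lambda>t. exp (- t))"
      by (simp, intro continuous_intros)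
    from continuous_map_compose[OF continuous_map_vague_integral[OF LB_plus_subset_CB_plus[OF f]] this]
    have "continuous_map (vague_topology Bb) euclideanreal (\<lambda>\<mu>. exp (- (\<integral>x. f x \<partial>\<mu>)))"
      by (simp add: o_def)
    moreover have "bounded ((\<lambda>\<mu>. exp (- (\<integral>x. f x \<partial>\<mu>))) ` topspace (vague_topology Bb))"
      using exp_integral_bounded[OF f] unfolding bounded_iff by (intro exI[of _ 1]) auto
    ultimately show "(\<lambda>n. \<integral>\<omega>. exp (- (\<integral>x. f x \<partial>N n \<omega>)) \<partial>P n)
        \<longlonglongrightarrow> (\<integral>\<omega>. exp (- (\<integral>x. f x \<partial>N\<^sub>0 \<omega>)) \<partial>P\<^sub>0)"
      by (intro conv[unfolded converges_in_distribution_def, rule_format] conjI)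
  next
    assume conv: "\<forall>f\<in>LB_plus Bb d. (\<lambda>n. \<integral>\<omega>. exp (- (\<integral>x. f x \<partial>N n \<omega>)) \<partial>P n)
        \<longlonglongrightarrow> (\<integral>\<omega>. exp (- (\<integral>x. f x \<partial>N\<^sub>0 \<omega>)) \<partial>P\<^sub>0)"
    show "converges_in_distribution (vague_topology Bb) P N P\<^sub>0 N\<^sub>0"
    proof (rule vague_topology_countably_generated)
      fix F assume F: "countable F" "F \<subseteq> LB_plus Bb d"
        "\<And>U \<nu>. openin (vague_topology Bb) U \<Longrightarrow> \<nu> \<in> U \<Longrightarrow>
          \<exists>I \<delta>. finite I \<and> I \<subseteq> exp_integral ` F \<and> \<delta> > 0
            \<and> (\<forall>\<mu>\<in>\<M>. (\<forall>v\<in>I. \<bar>v \<mu> - v \<nu>\<bar> < \<delta>) \<longrightarrow> \<mu> \<in> U)"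
      show ?thesis
      \<comment> \<open>The countable family from \<open>F\<close> describes the topology, while
        convergence of expectations is used for the whole class, whose closure under products makes
        the span an algebra.\<close>
      proof (rule laplace.converges_in_distribution_class)
        show "countable (exp_integral ` F)" using F(1) by simp
        show "exp_integral ` F \<subseteq> exp_integral ` LB_plus Bb d"
          using F(2) by (rule image_mono)
        show "topspace (vague_topology Bb) = space (lf_measure_algebra Bb)"
          by (simp add: topspace_vague space_lf_algebra)
        show "\<exists>I \<delta>. finite I \<and> I \<subseteq> exp_integral ` F \<and> \<delta> > 0
            \<and> (\<forall>\<mu>\<in>space (lf_measure_algebra Bb). (\<forall>v\<in>I. \<bar>v \<mu> - v \<nu>\<bar> < \<delta>) \<longrightarrow> \<mu> \<in> U)"
          if "openin (vague_topology Bb) U" "\<nu> \<in> U" for U \<nu>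
          using F(3)[OF that] unfolding space_lf_algebra .
        fix w assume "w \<in> exp_integral ` LB_plus Bb d"
        then show "(\<lambda>n. \<integral>\<omega>. w (N n \<omega>) \<partial>P n) \<longlonglongrightarrow> (\<integral>\<omega>. w (N\<^sub>0 \<omega>) \<partial>P\<^sub>0)"
          using conv by auto
      qed (use assms(3,4) in \<open>simp_all add: random_measure_def\<close>)
    qed
  qed
qed

end
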